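(* There is a function $g\in L^2(\mathbb{R})$ such that $(g,1,1)=(E_mT_ng)_{m,n\in\mathbb{Z}}$ is a Weyl-Heisenberg frame for $L^2(\mathbb{R})$ and such that the WH-frame Identity holds for all $f\in L^2(\mathbb{R})$ in the sense that the series on its right-hand side converges symmetrically with equality in the identity, i.e. $$\sum_{m,n\in\mathbb{Z}}|\langle f,E_mT_ng\rangle|^2=\lim_{K\to\infty}\sum_{k=-K}^{K}\int_{\mathbb{R}}\overline{f(t)}f(t-k)G_k(t)\,dt\quad\text{for all } f\in L^2(\mathbb{R}).$$ However, there is an $h\in L^2(\mathbb{R})$ for which the series on the right-hand side of the WH-frame Identity does not converge, i.e. $$\lim_{K,L\to\infty}\sum_{k=-L}^{K}\int_{\mathbb{R}}\overline{h(t)}h(t-k)G_k(t)\,dt$$ does not exist (as a finite number).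
   Context: For $c\in\mathbb{R}$ let $T_cf(x)=f(x-c)$ and $E_cf(x)=e^{2\pi i c x}f(x)$. The system $(g,1,1)=(E_mT_ng)_{m,n\in\mathbb{Z}}$ is a Weyl-Heisenberg frame (WH-frame) if there are constants $A,B>0$ with $A\|f\|^2\le\sum_{m,n\in\mathbb{Z}}|\langle f,E_mT_ng\rangle|^2\le B\|f\|^2$ for all $f\in L^2(\mathbb{R})$. Put $G_k(t)=\sum_{n\in\mathbb{Z}}g(t-n)\overline{g(t-n-k)}$ for $k\in\mathbb{Z}$. The WH-frame Identity for $f$ (with parameters $a=b=1$) is $\sum_{m,n\in\mathbb{Z}}|\langle f,E_mT_ng\rangle|^2=\sum_{k\in\mathbb{Z}}\int_{\mathbb{R}}\overline{f(t)}f(t-k)G_k(t)\,dt$. In $\lim_{K,L\to\infty}$ the indices $K$ and $L$ tend to infinity independently. *)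

theory Defs
  imports "HOL-Analysis.Analysis"
begin

text \<open>
  Elements of \<open>L\<^sup>2(\<real>)\<close> are represented by Borel functions. Every Lebesgue class has a Borel
  representative, and all quantities below depend only on the class.
\<close>

definition L2 :: "(real \<Rightarrow> complex) set" where
  "L2 = {f. f \<in> borel_measurable lborel \<and> integrable lborel (\<lambda>x. (cmod (f x))\<^sup>2)}"

definition L2_inner :: "(real \<Rightarrow> complex) \<Rightarrow> (real \<Rightarrow> complex) \<Rightarrow> complex" where
  "L2_inner f g = (LINT x|lborel. f x * cnj (g x))"

definition L2_norm :: "(real \<Rightarrow> complex) \<Rightarrow> real" where
  "L2_norm f = sqrt (LINT x|lborel. (cmod (f x))\<^sup>2)"

definition translation :: "real \<Rightarrow> (real \<Rightarrow> complex) \<Rightarrow> real \<Rightarrow> complex" where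
  "translation c f = (\<lambda>x. f (x - c))"

definition modulation :: "real \<Rightarrow> (real \<Rightarrow> complex) \<Rightarrow> real \<Rightarrow> complex" where
  "modulation c f = (\<lambda>x. exp (2 * of_real pi * \<i> * of_real c * of_real x) * f x)"

definition WH_coeff_sq :: "(real \<Rightarrow> complex) \<Rightarrow> (real \<Rightarrow> complex) \<Rightarrow> int \<times> int \<Rightarrow> real" where
  "WH_coeff_sq g f = (\<lambda>(m, n).
     (cmod (L2_inner f (modulation (of_int m) (translation (of_int n) g))))\<^sup>2)"

text \<open>
  Summability is required explicitly, since \<^const>\<open>infsum\<close> is 0 on families that are not summable;
  it is the finiteness that the upper frame bound expresses.
\<close>

definition WH_frame :: "(real \<Rightarrow> complex) \<Rightarrow> bool" where
  "WH_frame g \<longleftrightarrow> (\<exists>A B. 0 < A \<and> 0 < B \<and>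
     (\<forall>f\<in>L2. WH_coeff_sq g f summable_on UNIV \<and>
        A * (L2_norm f)\<^sup>2 \<le> (\<Sum>\<^sub>\<infinity>mn\<in>UNIV. WH_coeff_sq g f mn) \<and>
        (\<Sum>\<^sub>\<infinity>mn\<in>UNIV. WH_coeff_sq g f mn) \<le> B * (L2_norm f)\<^sup>2))"

text \<open>
  For \<open>g \<in> L2\<close> the series defining \<open>G k t\<close> converges absolutely for almost every \<open>t\<close>; on the
  exceptional null set \<^const>\<open>infsum\<close> may take the value 0. If \<open>g\<close> generates a frame,
  \<open>G k\<close> is essentially bounded, so the integrals in \<open>WH_term\<close> are genuine for \<open>f \<in> L2\<close>.
\<close>

definition G :: "(real \<Rightarrow> complex) \<Rightarrow> int \<Rightarrow> real \<Rightarrow> complex" where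
  "G g k t = (\<Sum>\<^sub>\<infinity>n\<in>(UNIV :: int set). g (t - of_int n) * cnj (g (t - of_int n - of_int k)))"

definition WH_term :: "(real \<Rightarrow> complex) \<Rightarrow> (real \<Rightarrow> complex) \<Rightarrow> int \<Rightarrow> complex" where
  "WH_term g f k = (LINT t|lborel. cnj (f t) * f (t - of_int k) * G g k t)"

end

theory Submission
  imports Defs
begin

text \<open>
  Let \<open>g\<close> be constant on every interval \<open>[n, n + 1)\<close>, with value \<open>a n\<close> there. Then \<open>G\<^sub>k\<close> is the
  constant \<open>\<Sum>n. a n * cnj (a (n - k))\<close>, which is the \<open>k\<close>-th Fourier coefficient of \<open>|A|\<^sup>2\<close> for the
  \<open>1\<close>-periodic function \<open>A\<close> whose Fourier coefficients are the \<open>a n\<close>. Cut \<open>f\<close> into its fibres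
  \<open>x\<^sub>t = (f (t + j))\<^sub>j\<close>, \<open>0 \<le> t < 1\<close>. By Parseval in the modulation parameter, the sum of the
  squared frame coefficients is the integral over \<open>t\<close> of the squared \<open>\<ell>\<^sup>2\<close>-norm of the image of
  \<open>x\<^sub>t\<close> under the convolution operator with symbol \<open>A\<close>; so bounds on \<open>|A|\<^sup>2\<close> are frame bounds.
  The right-hand side of the identity integrates over \<open>t\<close> the Fourier partial sums of \<open>|A|\<^sup>2\<close>,
  acting on \<open>x\<^sub>t\<close> as convolution operators. Symmetric convergence for all \<open>f\<close> follows when these
  partial sums are uniformly bounded, and one-sided convergence fails when the one-sided partial
  sums are not.

  A jump does this. The square wave \<open>q = \<plusminus>1\<close> has bounded symmetric partial sums, while its
  one-sided sums are, up to a constant, those of \<open>\<Sum> exp (2 \<pi> i k \<xi>) / k\<close> over odd \<open>k > 0\<close>,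
  which has a logarithmic singularity. The window uses \<open>A = (3 + q) / 2\<close>, with values \<open>2\<close> and \<open>1\<close>, so that
  \<open>|A|\<^sup>2 = (5 + 3 q) / 2\<close> lies between \<open>1\<close> and \<open>4\<close>.

  The square wave acts on sequences as a discrete Hilbert transform, with kernel
  \<open>2 / (i \<pi> n)\<close> at odd \<open>n\<close>. Since \<open>|q| = 1\<close> it is an isometry (\<open>hilbert_isometry\<close>). The uniform
  bound on the symmetric partial sums (\<open>hilbert_partial_bound\<close>) comes from averaging: the
  Cesaro means are averages of compressions of the isometry to windows of
  consecutive integers, and they differ from the partial sums by a bounded amount because the
  kernel decays like \<open>1 / n\<close>. Convergence for every sequence then follows from convergence for
  finitely supported ones (\<open>hilbert_partial_tendsto\<close>), and dominated convergence integrates it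
  over the fibres (\<open>WH_identity_symmetric\<close>).

  For the divergence, \<open>h\<close> is the step function with values \<open>1 / (sqrt n * (1 + ln n))\<close>. Its
  \<open>k\<close>-th autocorrelation decays no faster than \<open>1 / ln k\<close>, so that the half-series dominates
  \<open>\<Sum> 1 / (n * ln n) = \<infinity>\<close> (\<open>one_sided_sum_lower_bound\<close>).
\<close>

section \<open>Fourier series on the unit interval\<close>

abbreviation unit_interval :: "real measure"
  where "unit_interval \<equiv> restrict_space lborel {0..<1}"

lemma emeasure_unit_interval [simp]: "emeasure unit_interval {0..<1} = 1"
  by (simp add: emeasure_restrict_space)

lemma measure_unit_interval [simp]: "measure unit_interval {0..<1} = 1"
  by (simp add: measure_def)

interpretation unit_interval: finite_measure unit_interval
  by standard (simp add: space_restrict_space)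

lemma integrable_unit_interval_bounded:
  fixes f :: "real \<Rightarrow> 'a::{banach,second_countable_topology}"
  assumes "f \<in> borel_measurable unit_interval" "\<And>t. 0 \<le> t \<Longrightarrow> t < 1 \<Longrightarrow> norm (f t) \<le> C"
  shows "integrable unit_interval f"
  by (rule unit_interval.integrable_const_bound[where B = C])
     (use assms in \<open>auto simp: space_restrict_space intro!: AE_I2\<close>)

text \<open>
  The cut-off at \<open>b\<close> allows integrating the two halves of the square wave separately.
\<close>
lemma integral_unit_interval_FTC_upto:
  fixes f :: "real \<Rightarrow> 'a::euclidean_space"
  assumes F: "\<And>x. (F has_vector_derivative f x) (at x)" and f: "continuous_on UNIV f"
    and b: "0 \<le> b" "b \<le> 1"
  shows "(LINT t|unit_interval. (if t < b then f t else 0)) = F b - F 0"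
proof -
  have "(LINT t|unit_interval. (if t < b then f t else 0))
      = (LINT t|lborel. indicator {0..<1} t *\<^sub>R (if t < b then f t else 0))"
    by (subst integral_restrict_space) (auto simp: set_lebesgue_integral_def)
  also have "\<dots> = (LINT t|lborel. indicator {0..b} t *\<^sub>R f t)"
  proof (rule integral_cong_AE)
    have [measurable]: "f \<in> borel_measurable borel"
      using f by (rule borel_measurable_continuous_onI)
    show "(\<lambda>t. indicator {0..<1} t *\<^sub>R (if t < b then f t else 0)) \<in> borel_measurable lborel"
      "(\<lambda>t. indicator {0..b} t *\<^sub>R f t) \<in> borel_measurable lborel" by measurable
    show "AE t in lborel. indicator {0..<1} t *\<^sub>R (if t < b then f t else 0) = indicator {0..b} t *\<^sub>R f t"
      using AE_lborel_singleton[of b] by eventually_elim (use b in \<open>auto simp: indicator_def\<close>)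
  qed
  also have "\<dots> = F b - F 0"
    by (rule integral_FTC_atLeastAtMost)
       (auto intro: F[THEN has_vector_derivative_at_within] continuous_on_subset[OF f] b)
  finally show ?thesis .
qed

lemma integral_unit_interval_FTC:
  fixes f :: "real \<Rightarrow> 'a::euclidean_space"
  assumes F: "\<And>x. (F has_vector_derivative f x) (at x)" and f: "continuous_on UNIV f"
  shows "(LINT t|unit_interval. f t) = F 1 - F 0"
proof -
  have "(LINT t|unit_interval. f t) = (LINT t|unit_interval. (if t < 1 then f t else 0))"
    by (rule Bochner_Integration.integral_cong) (auto simp: space_restrict_space)
  then show ?thesis using integral_unit_interval_FTC_upto[OF F f, of 1] by simp
qed

definition character :: "int \<Rightarrow> real \<Rightarrow> complex"
  where "character m t = cis (2 * pi * of_int m * t)"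

lemma norm_character [simp]: "norm (character m t) = 1"
  by (simp add: character_def)

lemma character_mult: "character m t * character n t = character (m + n) t"
  by (simp add: character_def cis_mult algebra_simps)

lemma cnj_character: "cnj (character m t) = character (- m) t"
  by (simp add: character_def cis_cnj)

lemma character_0 [simp]: "character 0 t = 1"
  by (simp add: character_def)

lemma character_add_int: "character m (t + of_int j) = character m t"
proof -
  have "character m (t + of_int j) = character m t * cis (2 * pi * of_int (m * j))"
    by (simp add: character_def cis_mult algebra_simps)
  also have "cis (2 * pi * of_int (m * j)) = 1"
    by (rule cis_multiple_2pi) simp
  finally show ?thesis by simp
qed

lemma continuous_on_character [continuous_intros]: "continuous_on A (character m)"
  unfolding character_def by (intro continuous_intros)

lemma measurable_character [measurable]: "character m \<in> borel_measurable borel"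
  by (rule borel_measurable_continuous_onI) (rule continuous_on_character)

lemma measurable_character' [measurable]: "character m \<in> borel_measurable unit_interval"
  by (rule measurable_restrict_space1) simp

lemma measurable_cnj_character [measurable]:
  "(\<lambda>t. cnj (character m t)) \<in> borel_measurable unit_interval"
  by (simp add: cnj_character)

lemma has_vector_derivative_character:
  "(character m has_vector_derivative (2 * pi * \<i> * of_int m) * character m t) (at t)"
proof -
  have eq: "character m = (\<lambda>t. exp (of_real t * (2 * pi * \<i> * of_int m)))"
    by (auto simp: character_def cis_conv_exp algebra_simps fun_eq_iff)
  show ?thesis unfolding eq
    by (auto intro!: derivative_eq_intros has_vector_derivative_real_field simp: field_simps)
qed

lemma character_int [simp]: "character m 1 = 1" "character m 0 = 1"
  using character_add_int[of m 0 1] by (auto simp: character_def)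

lemma integral_character: "(LINT t|unit_interval. character m t) = (if m = 0 then 1 else 0)"
proof (cases "m = 0")
  case True
  then show ?thesis by (simp add: space_restrict_space)
next
  case False
  have "(LINT t|unit_interval. character m t)
      = character m 1 / (2 * pi * \<i> * of_int m) - character m 0 / (2 * pi * \<i> * of_int m)"
    using False
    by (intro integral_unit_interval_FTC)
       (auto intro!: continuous_intros derivative_eq_intros has_vector_derivative_character
             simp: field_simps has_vector_derivative_divide)
  then show ?thesis using False by simp
qed

lemma integrable_character [simp]: "integrable unit_interval (character m)"
  by (rule integrable_unit_interval_bounded[where C=1]) auto

definition square_integrable_unit :: "(real \<Rightarrow> complex) \<Rightarrow> bool"
  where "square_integrable_unit P \<longleftrightarrow>
    P \<in> borel_measurable unit_interval \<and> integrable unit_interval (\<lambda>t. (cmod (P t))\<^sup>2)"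

definition fourier_coeff :: "(real \<Rightarrow> complex) \<Rightarrow> int \<Rightarrow> complex"
  where "fourier_coeff P m = (LINT t|unit_interval. P t * cnj (character m t))"

definition trig_sum :: "int set \<Rightarrow> (int \<Rightarrow> complex) \<Rightarrow> real \<Rightarrow> complex"
  where "trig_sum F d t = (\<Sum>m\<in>F. d m * character m t)"

lemma measurable_trig_sum [measurable]: "trig_sum F d \<in> borel_measurable unit_interval"
  unfolding trig_sum_def by measurable

lemma norm_trig_sum_le: "cmod (trig_sum F d t) \<le> (\<Sum>m\<in>F. cmod (d m))"
  unfolding trig_sum_def by (rule order_trans[OF norm_sum]) (simp add: norm_mult)

lemma square_integrable_unit_bounded:
  assumes "P \<in> borel_measurable unit_interval" "\<And>t. 0 \<le> t \<Longrightarrow> t < 1 \<Longrightarrow> cmod (P t) \<le> C"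
  shows "square_integrable_unit P"
  unfolding square_integrable_unit_def using assms
  by (auto intro!: integrable_unit_interval_bounded[where C="C\<^sup>2"] power_mono)

lemma square_integrable_unit_trig_sum: "square_integrable_unit (trig_sum F d)"
  by (rule square_integrable_unit_bounded[OF measurable_trig_sum norm_trig_sum_le])

lemma two_mult_le_squares: "2 * (a * b) \<le> a\<^sup>2 + (b::real)\<^sup>2"
  using zero_le_power2[of "a - b"] by (simp add: power2_eq_square algebra_simps)

lemma cmod_add_sq_le: "(cmod (x + y))\<^sup>2 \<le> 2 * (cmod x)\<^sup>2 + 2 * (cmod y)\<^sup>2"
proof -
  have "(cmod (x + y))\<^sup>2 \<le> (cmod x + cmod y)\<^sup>2"
    by (intro power_mono norm_triangle_ineq) auto
  also have "\<dots> \<le> 2 * (cmod x)\<^sup>2 + 2 * (cmod y)\<^sup>2"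
    using two_mult_le_squares[of "cmod x" "cmod y"] by (simp add: power2_sum)
  finally show ?thesis .
qed

lemma square_integrable_unit_add:
  assumes "square_integrable_unit P" "square_integrable_unit Q"
  shows "square_integrable_unit (\<lambda>t. P t + Q t)"
proof -
  from assms have [measurable]: "P \<in> borel_measurable unit_interval" "Q \<in> borel_measurable unit_interval"
    and i: "integrable unit_interval (\<lambda>t. 2 * (cmod (P t))\<^sup>2 + 2 * (cmod (Q t))\<^sup>2)"
    by (auto simp: square_integrable_unit_def)
  have "integrable unit_interval (\<lambda>t. (cmod (P t + Q t))\<^sup>2)"
    by (rule Bochner_Integration.integrable_bound[OF i]) (auto simp: cmod_add_sq_le)
  then show ?thesis by (simp add: square_integrable_unit_def)
qed

lemma square_integrable_unit_cmult:
  assumes "square_integrable_unit P" shows "square_integrable_unit (\<lambda>t. c * P t)"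
  using assms by (auto simp: square_integrable_unit_def norm_mult power_mult_distrib)

lemma square_integrable_unit_diff:
  assumes "square_integrable_unit P" "square_integrable_unit Q"
  shows "square_integrable_unit (\<lambda>t. P t - Q t)"
  using square_integrable_unit_add[OF assms(1) square_integrable_unit_cmult[OF assms(2), of "-1"]]
  by simp

lemma square_integrable_unit_mult_bounded:
  assumes "square_integrable_unit P" "Q \<in> borel_measurable unit_interval"
    "\<And>t. 0 \<le> t \<Longrightarrow> t < 1 \<Longrightarrow> cmod (Q t) \<le> C"
  shows "square_integrable_unit (\<lambda>t. P t * Q t)"
    and "(LINT t|unit_interval. (cmod (P t * Q t))\<^sup>2) \<le> C\<^sup>2 * (LINT t|unit_interval. (cmod (P t))\<^sup>2)"
proof -
  from assms have [measurable]: "P \<in> borel_measurable unit_interval" "Q \<in> borel_measurable unit_interval"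
    and i: "integrable unit_interval (\<lambda>t. C\<^sup>2 * (cmod (P t))\<^sup>2)"
    by (auto simp: square_integrable_unit_def)
  have le: "(cmod (P t * Q t))\<^sup>2 \<le> C\<^sup>2 * (cmod (P t))\<^sup>2" if "0 \<le> t" "t < 1" for t
  proof -
    have "(cmod (Q t))\<^sup>2 \<le> C\<^sup>2" using assms(3)[OF that] by (intro power_mono) auto
    then have "(cmod (Q t))\<^sup>2 * (cmod (P t))\<^sup>2 \<le> C\<^sup>2 * (cmod (P t))\<^sup>2"
      by (rule mult_right_mono) simp
    then show ?thesis by (simp add: norm_mult power_mult_distrib mult.commute)
  qed
  have int: "integrable unit_interval (\<lambda>t. (cmod (P t * Q t))\<^sup>2)"
    by (rule Bochner_Integration.integrable_bound[OF i])
       (auto simp: space_restrict_space intro!: AE_I2 order_trans[OF le])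
  then show "square_integrable_unit (\<lambda>t. P t * Q t)" by (simp add: square_integrable_unit_def)
  have "(LINT t|unit_interval. (cmod (P t * Q t))\<^sup>2) \<le> (LINT t|unit_interval. C\<^sup>2 * (cmod (P t))\<^sup>2)"
    by (rule integral_mono[OF int i]) (use le in \<open>auto simp: space_restrict_space\<close>)
  then show "(LINT t|unit_interval. (cmod (P t * Q t))\<^sup>2) \<le> C\<^sup>2 * (LINT t|unit_interval. (cmod (P t))\<^sup>2)"
    by simp
qed

lemma square_integrable_unit_imp_integrable:
  assumes "square_integrable_unit P" shows "integrable unit_interval P"
proof -
  from assms have [measurable]: "P \<in> borel_measurable unit_interval"
    and i: "integrable unit_interval (\<lambda>t. 1 + (cmod (P t))\<^sup>2)"
    by (auto simp: square_integrable_unit_def)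
  have "cmod z \<le> 1 + (cmod z)\<^sup>2" for z :: complex
    using two_mult_le_squares[of "cmod z" 1] norm_ge_zero[of z]
    unfolding mult_1_right power_one by linarith
  then show ?thesis
    by (intro Bochner_Integration.integrable_bound[OF i]) auto
qed

lemma square_integrable_unit_character:
  assumes "square_integrable_unit P"
  shows "square_integrable_unit (\<lambda>t. P t * cnj (character m t))"
  by (rule square_integrable_unit_mult_bounded(1)[OF assms, of _ 1]) auto

text \<open>
  Completing the square. With \<open>d\<close> the Fourier coefficients the last sum vanishes, which gives both
  Bessel's inequality and the optimality of the Fourier partial sums; with \<open>P = 0\<close> it is the
  orthonormality of the characters.
\<close>
lemma trig_sum_distance:
  assumes P: "square_integrable_unit P" and F: "finite F"
  shows "(LINT t|unit_interval. (cmod (P t - trig_sum F d t))\<^sup>2)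
    = (LINT t|unit_interval. (cmod (P t))\<^sup>2) - (\<Sum>m\<in>F. (cmod (fourier_coeff P m))\<^sup>2)
      + (\<Sum>m\<in>F. (cmod (fourier_coeff P m - d m))\<^sup>2)"
proof -
  let ?T = "trig_sum F d" and ?c = "fourier_coeff P"
  note [simp] = square_integrable_unit_imp_integrable[OF square_integrable_unit_character]
  have inner: "(LINT t|unit_interval. Q t * cnj (?T t)) = (\<Sum>m\<in>F. cnj (d m) * fourier_coeff Q m)"
    "integrable unit_interval (\<lambda>t. Q t * cnj (?T t))"
    if Q: "square_integrable_unit Q" for Q
  proof -
    have e: "(\<lambda>t. Q t * cnj (?T t)) = (\<lambda>t. \<Sum>m\<in>F. cnj (d m) * (Q t * cnj (character m t)))"
      by (simp add: trig_sum_def sum_distrib_left mult_ac)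
    show "(LINT t|unit_interval. Q t * cnj (?T t)) = (\<Sum>m\<in>F. cnj (d m) * fourier_coeff Q m)"
      "integrable unit_interval (\<lambda>t. Q t * cnj (?T t))"
      unfolding e fourier_coeff_def using Q by simp_all
  qed
  have cT: "fourier_coeff ?T m = d m" if "m \<in> F" for m
  proof -
    have "fourier_coeff ?T m = (LINT t|unit_interval. (\<Sum>n\<in>F. d n * character (n - m) t))"
      by (simp add: fourier_coeff_def trig_sum_def cnj_character sum_distrib_right mult.assoc character_mult)
    also have "\<dots> = (\<Sum>n\<in>F. d n * (if n - m = 0 then 1 else 0))"
      by (simp add: integral_character)
    also have "\<dots> = d m" using that F by (simp add: if_distrib cong: if_cong)
    finally show ?thesis .
  qed
  have T: "square_integrable_unit ?T" by (rule square_integrable_unit_trig_sum)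
  have expand: "complex_of_real ((cmod (x - y))\<^sup>2)
      = of_real ((cmod x)\<^sup>2) - x * cnj y - cnj (x * cnj y) + y * cnj y" for x y
    by (simp add: complex_norm_square algebra_simps del: of_real_power)
  have iP: "integrable unit_interval (\<lambda>t. complex_of_real ((cmod (P t))\<^sup>2))"
    using P by (auto simp: square_integrable_unit_def simp del: of_real_power)
  have "complex_of_real (LINT t|unit_interval. (cmod (P t - ?T t))\<^sup>2)
      = (LINT t|unit_interval. of_real ((cmod (P t))\<^sup>2) - P t * cnj (?T t) - cnj (P t * cnj (?T t)) + ?T t * cnj (?T t))"
    by (subst integral_complex_of_real[symmetric], subst expand) (rule refl)
  also have "\<dots> = of_real (LINT t|unit_interval. (cmod (P t))\<^sup>2)
     - (\<Sum>m\<in>F. cnj (d m) * ?c m) - cnj (\<Sum>m\<in>F. cnj (d m) * ?c m) + (\<Sum>m\<in>F. cnj (d m) * d m)"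
  proof -
    have "(LINT t|unit_interval. ?T t * cnj (?T t)) = (\<Sum>m\<in>F. cnj (d m) * d m)"
      using inner(1)[OF T] by (simp add: cT cong: sum.cong)
    moreover have "(LINT t|unit_interval. cnj (P t * cnj (?T t))) = cnj (\<Sum>m\<in>F. cnj (d m) * ?c m)"
      using inner[OF P] by (subst Bochner_Integration.integral_cnj) simp
    moreover have "integrable unit_interval (\<lambda>t. cnj (P t * cnj (?T t)))"
      using inner(2)[OF P] by (simp del: complex_cnj_mult)
    ultimately show ?thesis
      using inner[OF P] inner[OF T] iP by (simp del: complex_cnj_mult of_real_power)
  qed
  also have "\<dots> = of_real ((LINT t|unit_interval. (cmod (P t))\<^sup>2) - (\<Sum>m\<in>F. (cmod (?c m))\<^sup>2)
      + (\<Sum>m\<in>F. (cmod (?c m - d m))\<^sup>2))"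
    by (simp add: complex_norm_square algebra_simps sum.distrib sum_subtractf del: of_real_power)
  finally show ?thesis by (simp only: of_real_eq_iff)
qed

section \<open>Completeness of the characters and Parseval\<close>

lemma trig_sum_mono_set:
  assumes "finite F'" "F \<subseteq> F'"
  shows "trig_sum F d = trig_sum F' (\<lambda>m. if m \<in> F then d m else 0)"
  unfolding trig_sum_def fun_eq_iff
  by (intro allI sum.mono_neutral_cong_left) (use assms in auto)

lemma trig_sum_add:
  assumes "finite F" "finite F'"
  shows "\<exists>d''. \<forall>t. trig_sum F d t + trig_sum F' d' t = trig_sum (F \<union> F') d'' t"
proof -
  have "trig_sum F d t + trig_sum F' d' t =
      trig_sum (F \<union> F') (\<lambda>m. (if m \<in> F then d m else 0) + (if m \<in> F' then d' m else 0)) t" for t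
    unfolding trig_sum_mono_set[of "F \<union> F'" F d, OF finite_UnI[OF assms] Un_upper1]
      trig_sum_mono_set[of "F \<union> F'" F' d', OF finite_UnI[OF assms] Un_upper2]
    by (simp add: trig_sum_def sum.distrib distrib_right)
  then show ?thesis by blast
qed

text \<open>
  Approximability by trigonometric polynomials in the \<open>L\<^sup>2\<close>-norm. Parseval for a single function
  only needs this for that function. The property is proved for more and more functions: the
  identity, hence polynomials, hence continuous functions, hence bounded and then arbitrary ones.
\<close>
definition trig_approximable :: "(real \<Rightarrow> complex) \<Rightarrow> bool"
  where "trig_approximable P \<longleftrightarrow> square_integrable_unit P \<and>
    (\<forall>\<epsilon>>0. \<exists>F d. finite F \<and> (LINT t|unit_interval. (cmod (P t - trig_sum F d t))\<^sup>2) < \<epsilon>)"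

lemma integral_cmod_add_sq_le:
  assumes "square_integrable_unit P" "square_integrable_unit Q"
  shows "(LINT t|unit_interval. (cmod (P t + Q t))\<^sup>2)
    \<le> 2 * (LINT t|unit_interval. (cmod (P t))\<^sup>2) + 2 * (LINT t|unit_interval. (cmod (Q t))\<^sup>2)"
proof -
  have "(LINT t|unit_interval. (cmod (P t + Q t))\<^sup>2)
    \<le> (LINT t|unit_interval. 2 * (cmod (P t))\<^sup>2 + 2 * (cmod (Q t))\<^sup>2)"
    using assms square_integrable_unit_add[OF assms]
    by (intro integral_mono) (auto simp: square_integrable_unit_def cmod_add_sq_le)
  then show ?thesis
    using assms by (simp add: square_integrable_unit_def)
qed

lemma trig_approximable_closed:
  assumes P: "square_integrable_unit P"
    and Q: "\<And>\<epsilon>. \<epsilon> > 0 \<Longrightarrow> \<exists>Q. trig_approximable Q \<and> (LINT t|unit_interval. (cmod (P t - Q t))\<^sup>2) < \<epsilon>"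
  shows "trig_approximable P"
  unfolding trig_approximable_def
proof (intro conjI allI impI P)
  fix \<epsilon> :: real assume "\<epsilon> > 0"
  then obtain Q where Q: "trig_approximable Q" "(LINT t|unit_interval. (cmod (P t - Q t))\<^sup>2) < \<epsilon> / 4"
    using Q[of "\<epsilon> / 4"] by auto
  then have sQ: "square_integrable_unit Q" by (simp add: trig_approximable_def)
  obtain F d where F: "finite F" "(LINT t|unit_interval. (cmod (Q t - trig_sum F d t))\<^sup>2) < \<epsilon> / 4"
    using Q(1) \<open>\<epsilon> > 0\<close> unfolding trig_approximable_def by (metis divide_pos_pos zero_less_numeral)
  have "(LINT t|unit_interval. (cmod (P t - trig_sum F d t))\<^sup>2) =
     (LINT t|unit_interval. (cmod ((P t - Q t) + (Q t - trig_sum F d t)))\<^sup>2)" by simp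
  also have "\<dots> \<le> 2 * (LINT t|unit_interval. (cmod (P t - Q t))\<^sup>2) + 2 * (LINT t|unit_interval. (cmod (Q t - trig_sum F d t))\<^sup>2)"
    by (intro integral_cmod_add_sq_le square_integrable_unit_diff P sQ square_integrable_unit_trig_sum)
  also have "\<dots> < \<epsilon>" using Q(2) F(2) by simp
  finally show "\<exists>F d. finite F \<and> (LINT t|unit_interval. (cmod (P t - trig_sum F d t))\<^sup>2) < \<epsilon>"
    using F(1) by blast
qed

lemma trig_approximable_add:
  assumes "trig_approximable P" "trig_approximable Q"
  shows "trig_approximable (\<lambda>t. P t + Q t)"
  unfolding trig_approximable_def
proof (intro conjI allI impI)
  from assms have sP: "square_integrable_unit P" and sQ: "square_integrable_unit Q"
    by (auto simp: trig_approximable_def)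
  then show "square_integrable_unit (\<lambda>t. P t + Q t)" by (rule square_integrable_unit_add)
  fix \<epsilon> :: real assume "\<epsilon> > 0"
  then have e: "\<epsilon> / 4 > 0" by simp
  obtain F d where F: "finite F" "(LINT t|unit_interval. (cmod (P t - trig_sum F d t))\<^sup>2) < \<epsilon> / 4"
    using assms(1) e unfolding trig_approximable_def by meson
  obtain F' d' where F': "finite F'" "(LINT t|unit_interval. (cmod (Q t - trig_sum F' d' t))\<^sup>2) < \<epsilon> / 4"
    using assms(2) e unfolding trig_approximable_def by meson
  obtain d'' where d'': "\<And>t. trig_sum F d t + trig_sum F' d' t = trig_sum (F \<union> F') d'' t"
    using trig_sum_add[OF F(1) F'(1)] by blast
  have "(LINT t|unit_interval. (cmod (P t + Q t - trig_sum (F \<union> F') d'' t))\<^sup>2) =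
     (LINT t|unit_interval. (cmod ((P t - trig_sum F d t) + (Q t - trig_sum F' d' t)))\<^sup>2)"
    by (simp add: d''[symmetric] algebra_simps)
  also have "\<dots> \<le> 2 * (LINT t|unit_interval. (cmod (P t - trig_sum F d t))\<^sup>2) + 2 * (LINT t|unit_interval. (cmod (Q t - trig_sum F' d' t))\<^sup>2)"
    by (intro integral_cmod_add_sq_le square_integrable_unit_diff sP sQ square_integrable_unit_trig_sum)
  also have "\<dots> < \<epsilon>" using F(2) F'(2) by simp
  finally show "\<exists>F d. finite F \<and> (LINT t|unit_interval. (cmod (P t + Q t - trig_sum F d t))\<^sup>2) < \<epsilon>"
    using F(1) F'(1) by blast
qed

lemma trig_approximable_trig_sum: "finite F \<Longrightarrow> trig_approximable (trig_sum F d)"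
  unfolding trig_approximable_def
  by (auto simp: square_integrable_unit_trig_sum intro!: exI[of _ F] exI[of _ d])

lemma trig_approximable_const: "trig_approximable (\<lambda>t. c)"
proof -
  have "(\<lambda>t. c) = trig_sum {0} (\<lambda>_. c)" by (simp add: trig_sum_def fun_eq_iff)
  then show ?thesis using trig_approximable_trig_sum[of "{0}" "\<lambda>_. c"] by simp
qed

lemma trig_approximable_mult_character:
  assumes "trig_approximable P"
  shows "trig_approximable (\<lambda>t. c * character k t * P t)"
  unfolding trig_approximable_def
proof (intro conjI allI impI)
  from assms have sP: "square_integrable_unit P" by (auto simp: trig_approximable_def)
  have *: "square_integrable_unit (\<lambda>t. Q t * (c * character k t))"
    "(LINT t|unit_interval. (cmod (Q t * (c * character k t)))\<^sup>2) \<le> (cmod c)\<^sup>2 * (LINT t|unit_interval. (cmod (Q t))\<^sup>2)"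
    if "square_integrable_unit Q" for Q
    by (rule square_integrable_unit_mult_bounded[OF that, where C = "cmod c"]; simp add: norm_mult)+
  show "square_integrable_unit (\<lambda>t. c * character k t * P t)"
    using *(1)[OF sP] by (simp add: mult_ac)
  fix \<epsilon> :: real assume "\<epsilon> > 0"
  then have e: "\<epsilon> / (1 + (cmod c)\<^sup>2) > 0" by (simp add: add_pos_nonneg)
  obtain F d where F: "finite F" "(LINT t|unit_interval. (cmod (P t - trig_sum F d t))\<^sup>2) < \<epsilon> / (1 + (cmod c)\<^sup>2)"
    using assms(1) e unfolding trig_approximable_def by meson
  have T: "c * character k t * trig_sum F d t = trig_sum ((+) k ` F) (\<lambda>m. c * d (m - k)) t" for t
    by (simp add: trig_sum_def sum_distrib_left sum.reindex character_mult[symmetric] mult_ac)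
  have diff: "c * character k t * P t - trig_sum ((+) k ` F) (\<lambda>m. c * d (m - k)) t
      = (P t - trig_sum F d t) * (c * character k t)" for t
    unfolding T[symmetric] by (rule trans[OF right_diff_distrib[symmetric] mult.commute])
  have "(LINT t|unit_interval. (cmod (c * character k t * P t - trig_sum ((+) k ` F) (\<lambda>m. c * d (m - k)) t))\<^sup>2)
    = (LINT t|unit_interval. (cmod ((P t - trig_sum F d t) * (c * character k t)))\<^sup>2)"
    by (simp only: diff)
  also have "\<dots> \<le> (cmod c)\<^sup>2 * (LINT t|unit_interval. (cmod (P t - trig_sum F d t))\<^sup>2)"
    by (intro * square_integrable_unit_diff sP square_integrable_unit_trig_sum)
  also have "\<dots> \<le> (1 + (cmod c)\<^sup>2) * (LINT t|unit_interval. (cmod (P t - trig_sum F d t))\<^sup>2)"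
    by (intro mult_right_mono) auto
  also have "\<dots> < \<epsilon>" using F(2) by (simp add: field_simps add_pos_nonneg)
  finally show "\<exists>F d. finite F \<and> (LINT t|unit_interval. (cmod (c * character k t * P t - trig_sum F d t))\<^sup>2) < \<epsilon>"
    using F(1) by (intro exI[of _ "(+) k ` F"] exI[of _ "\<lambda>m. c * d (m - k)"]) auto
qed

lemma trig_approximable_sum:
  assumes "\<And>i. i \<in> I \<Longrightarrow> trig_approximable (f i)"
  shows "trig_approximable (\<lambda>t. \<Sum>i\<in>I. f i t)"
  using assms
  by (induction I rule: infinite_finite_induct)
     (auto intro: trig_approximable_add simp: trig_approximable_const)

text \<open>
  Boundedness makes the approximable functions an algebra: multiplication by a bounded function is
  continuous in the \<open>L\<^sup>2\<close>-norm.
\<close>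
definition bounded_trig_approximable :: "(real \<Rightarrow> complex) \<Rightarrow> bool"
  where "bounded_trig_approximable P \<longleftrightarrow>
    trig_approximable P \<and> (\<exists>C. \<forall>t. 0 \<le> t \<longrightarrow> t < 1 \<longrightarrow> cmod (P t) \<le> C)"

text \<open>
  First replace \<open>P\<close> by a trigonometric polynomial, at the cost of the bound on \<open>Q\<close>; then the product is a
  combination of translates of \<open>Q\<close> in frequency, which are approximable because \<open>Q\<close> is.
\<close>
lemma bounded_trig_approximable_mult:
  assumes P: "bounded_trig_approximable P" and Q: "bounded_trig_approximable Q"
  shows "bounded_trig_approximable (\<lambda>t. P t * Q t)"
  unfolding bounded_trig_approximable_def
proof
  from P obtain C where C: "\<And>t. 0 \<le> t \<Longrightarrow> t < 1 \<Longrightarrow> cmod (P t) \<le> C"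
    by (auto simp: bounded_trig_approximable_def)
  from Q obtain D where D: "\<And>t. 0 \<le> t \<Longrightarrow> t < 1 \<Longrightarrow> cmod (Q t) \<le> D"
    by (auto simp: bounded_trig_approximable_def)
  show "\<exists>C. \<forall>t. 0 \<le> t \<longrightarrow> t < 1 \<longrightarrow> cmod (P t * Q t) \<le> C"
    by (intro exI[of _ "C * D"]) (auto simp: norm_mult intro!: mult_mono C D order_trans[OF norm_ge_zero C])
  have sP: "square_integrable_unit P" and sQ: "square_integrable_unit Q"
    using P Q by (auto simp: bounded_trig_approximable_def trig_approximable_def)
  then have [measurable]: "P \<in> borel_measurable unit_interval" "Q \<in> borel_measurable unit_interval"
    by (auto simp: square_integrable_unit_def)
  have aQ: "trig_approximable Q" using Q by (simp add: bounded_trig_approximable_def)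
  show "trig_approximable (\<lambda>t. P t * Q t)"
  proof (rule trig_approximable_closed)
    show "square_integrable_unit (\<lambda>t. P t * Q t)"
      by (rule square_integrable_unit_mult_bounded(1)[OF sP _ D]) auto
    fix \<epsilon> :: real assume "\<epsilon> > 0"
    then have e: "\<epsilon> / (1 + D\<^sup>2) > 0" by (simp add: add_pos_nonneg)
    obtain F d where F: "finite F" "(LINT t|unit_interval. (cmod (P t - trig_sum F d t))\<^sup>2) < \<epsilon> / (1 + D\<^sup>2)"
      using P e unfolding trig_approximable_def bounded_trig_approximable_def by meson
    have "(LINT t|unit_interval. (cmod (P t * Q t - trig_sum F d t * Q t))\<^sup>2)
        = (LINT t|unit_interval. (cmod ((P t - trig_sum F d t) * Q t))\<^sup>2)"
      by (simp add: algebra_simps)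
    also have "\<dots> \<le> D\<^sup>2 * (LINT t|unit_interval. (cmod (P t - trig_sum F d t))\<^sup>2)"
      by (rule square_integrable_unit_mult_bounded(2)
            [OF square_integrable_unit_diff[OF sP square_integrable_unit_trig_sum] _ D]) auto
    also have "\<dots> \<le> (1 + D\<^sup>2) * (LINT t|unit_interval. (cmod (P t - trig_sum F d t))\<^sup>2)"
      by (intro mult_right_mono) auto
    also have "\<dots> < \<epsilon>" using F(2) by (simp add: field_simps add_pos_nonneg)
    finally have lt: "(LINT t|unit_interval. (cmod (P t * Q t - trig_sum F d t * Q t))\<^sup>2) < \<epsilon>" .
    have "trig_approximable (\<lambda>t. trig_sum F d t * Q t)"
      unfolding trig_sum_def sum_distrib_right
      by (intro trig_approximable_sum trig_approximable_mult_character aQ)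
    with lt show "\<exists>R. trig_approximable R \<and> (LINT t|unit_interval. (cmod (P t * Q t - R t))\<^sup>2) < \<epsilon>"
      by blast
  qed
qed

lemma bounded_trig_approximable_const: "bounded_trig_approximable (\<lambda>t. c)"
  unfolding bounded_trig_approximable_def by (auto simp: trig_approximable_const)

lemma bounded_trig_approximable_add:
  assumes P: "bounded_trig_approximable P" and Q: "bounded_trig_approximable Q"
  shows "bounded_trig_approximable (\<lambda>t. P t + Q t)"
proof -
  from P obtain C where C: "\<And>t. 0 \<le> t \<Longrightarrow> t < 1 \<Longrightarrow> cmod (P t) \<le> C"
    by (auto simp: bounded_trig_approximable_def)
  from Q obtain D where D: "\<And>t. 0 \<le> t \<Longrightarrow> t < 1 \<Longrightarrow> cmod (Q t) \<le> D"
    by (auto simp: bounded_trig_approximable_def)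
  have "\<exists>C. \<forall>t. 0 \<le> t \<longrightarrow> t < 1 \<longrightarrow> cmod (P t + Q t) \<le> C"
    by (intro exI[of _ "C + D"]) (auto intro!: norm_triangle_le add_mono C D)
  then show ?thesis
    using P Q by (auto simp: bounded_trig_approximable_def intro: trig_approximable_add)
qed

lemma bounded_trig_approximable_sum:
  assumes "\<And>i. i \<in> I \<Longrightarrow> bounded_trig_approximable (f i)"
  shows "bounded_trig_approximable (\<lambda>t. \<Sum>i\<in>I. f i t)"
  using assms
  by (induction I rule: infinite_finite_induct)
     (auto intro: bounded_trig_approximable_add simp: bounded_trig_approximable_const)

lemma bounded_trig_approximable_power:
  assumes "bounded_trig_approximable P"
  shows "bounded_trig_approximable (\<lambda>t. P t ^ n)"
  by (induction n) (auto intro: bounded_trig_approximable_mult assms simp: bounded_trig_approximable_const)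

lemma fourier_coeff_identity:
  "fourier_coeff (\<lambda>t. of_real t) m = (if m = 0 then 1 / 2 else \<i> / (2 * pi * of_int m))"
proof (cases "m = 0")
  case True
  have "(LINT t|unit_interval. complex_of_real t) = (of_real 1)\<^sup>2 / 2 - (of_real 0)\<^sup>2 / 2"
    by (rule integral_unit_interval_FTC)
       (auto intro!: derivative_eq_intros continuous_intros
                     has_vector_derivative_real_field[where f = "\<lambda>z. z\<^sup>2 / 2"])
  then show ?thesis using True by (simp add: fourier_coeff_def)
next
  case False
  define w :: complex where "w = 2 * pi * \<i> * of_int (- m)"
  have w: "w \<noteq> 0" using False by (simp add: w_def)
  let ?F = "\<lambda>t. (of_real t / w - 1 / w\<^sup>2) * character (- m) t"
  have "(LINT t|unit_interval. of_real t * character (- m) t) = ?F 1 - ?F 0"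
  proof (rule integral_unit_interval_FTC)
    fix t :: real
    have "((\<lambda>t. of_real t / w - 1 / w\<^sup>2) has_vector_derivative 1 / w) (at t)"
      by (auto intro!: derivative_eq_intros has_vector_derivative_divide has_vector_derivative_of_real)
    note has_vector_derivative_mult[OF this has_vector_derivative_character[of "- m" t]]
    moreover have "(of_real t / w - 1 / w\<^sup>2) * (w * character (- m) t) + 1 / w * character (- m) t
        = of_real t * character (- m) t"
      using w by (simp add: field_simps power2_eq_square)
    ultimately show "(?F has_vector_derivative of_real t * character (- m) t) (at t)"
      by (simp only: w_def[symmetric])
  qed (auto intro!: continuous_intros)
  also have "\<dots> = 1 / w" using w by (simp add: field_simps)
  also have "\<dots> = \<i> / (2 * pi * of_int m)" using False by (simp add: w_def divide_simps)
  finally show ?thesis using False by (simp add: fourier_coeff_def cnj_character)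
qed


text \<open>
  The distance to the symmetric partial sums is explicit: the squared norm \<open>1/3\<close> exceeds the energy
  of the coefficients by a multiple of a tail of \<open>\<Sum> 1 / n\<^sup>2\<close>. Euler's value \<open>\<pi>\<^sup>2 / 6\<close> says exactly
  that this excess tends to \<open>0\<close>. Completeness of the characters follows from this one function by algebra
  and density.
\<close>
lemma bounded_trig_approximable_identity: "bounded_trig_approximable (\<lambda>t. of_real t)"
proof -
  let ?P = "\<lambda>t. complex_of_real t"
  have [measurable]: "?P \<in> borel_measurable unit_interval"
    by (rule measurable_restrict_space1) simp
  have sP: "square_integrable_unit ?P"
    by (rule square_integrable_unit_bounded[where C = 1]) auto
  have int: "(LINT t|unit_interval. (cmod (?P t))\<^sup>2) = 1 / 3"
  proof -
    have "(LINT t|unit_interval. t\<^sup>2) = 1 ^ 3 / 3 - 0 ^ 3 / (3::real)"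
      by (rule integral_unit_interval_FTC)
         (auto intro!: derivative_eq_intros continuous_intros
               simp: has_real_derivative_iff_has_vector_derivative[symmetric])
    then show ?thesis by simp
  qed
  have coeff: "(cmod (fourier_coeff ?P m))\<^sup>2 = 1 / (4 * pi\<^sup>2) * (1 / (of_int m)\<^sup>2)" if "m \<noteq> 0" for m
    using that by (simp add: fourier_coeff_identity norm_divide norm_mult power_divide power_mult_distrib)
  have energy: "(\<Sum>m\<in>{-int K..int K}. (cmod (fourier_coeff ?P m))\<^sup>2)
      = 1 / 4 + 1 / (2 * pi\<^sup>2) * (\<Sum>n<K. 1 / (real n + 1)\<^sup>2)" for K
  proof (induction K)
    case 0
    then show ?case by (simp add: fourier_coeff_identity power2_eq_square)
  next
    case (Suc K)
    have "{-int (Suc K)..int (Suc K)} = insert (int K + 1) (insert (- (int K + 1)) {-int K..int K})"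
      by auto
    then have "(\<Sum>m\<in>{-int (Suc K)..int (Suc K)}. (cmod (fourier_coeff ?P m))\<^sup>2)
      = (cmod (fourier_coeff ?P (int K + 1)))\<^sup>2 + ((cmod (fourier_coeff ?P (- (int K + 1))))\<^sup>2
         + (\<Sum>m\<in>{-int K..int K}. (cmod (fourier_coeff ?P m))\<^sup>2))"
      by (simp del: minus_add_distrib)
    also have "\<dots> = 1 / (4 * pi\<^sup>2) * (1 / (real K + 1)\<^sup>2) + (1 / (4 * pi\<^sup>2) * (1 / (real K + 1)\<^sup>2)
         + (1 / 4 + 1 / (2 * pi\<^sup>2) * (\<Sum>n<K. 1 / (real n + 1)\<^sup>2)))"
    proof -
      have "real_of_int (int K + 1) = real K + 1" by simp
      then have c: "(cmod (fourier_coeff ?P (int K + 1)))\<^sup>2 = 1 / (4 * pi\<^sup>2) * (1 / (real K + 1)\<^sup>2)"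
        "(cmod (fourier_coeff ?P (- (int K + 1))))\<^sup>2 = 1 / (4 * pi\<^sup>2) * (1 / (real K + 1)\<^sup>2)"
        by (subst coeff; simp only: of_int_minus power2_minus; linarith)+
      show ?thesis by (simp only: c Suc.IH)
    qed
    also have "\<dots> = 1 / 4 + 1 / (2 * pi\<^sup>2) * (\<Sum>n<Suc K. 1 / (real n + 1)\<^sup>2)"
      by (simp add: distrib_left)
    finally show ?case .
  qed
  have "(\<lambda>K. 1 / 3 - (1 / 4 + 1 / (2 * pi\<^sup>2) * (\<Sum>n<K. 1 / (real n + 1)\<^sup>2)))
      \<longlonglongrightarrow> 1 / 3 - (1 / 4 + 1 / (2 * pi\<^sup>2) * (pi\<^sup>2 / 6))"
    using inverse_squares_sums unfolding sums_def
    by (intro tendsto_intros) (simp add: add.commute)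
  then have lim: "(\<lambda>K. 1 / 3 - (1 / 4 + 1 / (2 * pi\<^sup>2) * (\<Sum>n<K. 1 / (real n + 1)\<^sup>2))) \<longlonglongrightarrow> 0"
    by simp
  have "trig_approximable ?P"
    unfolding trig_approximable_def
  proof (intro conjI allI impI sP)
    fix \<epsilon> :: real assume "\<epsilon> > 0"
    with lim obtain K where K: "1 / 3 - (1 / 4 + 1 / (2 * pi\<^sup>2) * (\<Sum>n<K. 1 / (real n + 1)\<^sup>2)) < \<epsilon>"
      by (metis (mono_tags, lifting) order_tendstoD(2) eventually_sequentially order_refl)
    have "(LINT t|unit_interval. (cmod (?P t - trig_sum {-int K..int K} (fourier_coeff ?P) t))\<^sup>2) < \<epsilon>"
      using K by (subst trig_sum_distance[OF sP]) (simp_all only: int energy, simp_all)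
    then show "\<exists>F d. finite F \<and> (LINT t|unit_interval. (cmod (?P t - trig_sum F d t))\<^sup>2) < \<epsilon>"
      by blast
  qed
  then show ?thesis by (auto simp: bounded_trig_approximable_def intro!: exI[of _ 1])
qed

text \<open>
  Bernstein polynomials are polynomials in the identity function, so they belong to the algebra of
  bounded approximable functions; they converge uniformly on the closed interval, end points included.
\<close>
lemma trig_approximable_continuous_real:
  fixes f :: "real \<Rightarrow> real"
  assumes f: "continuous_on UNIV f"
  shows "trig_approximable (\<lambda>t. of_real (f t))"
proof (rule trig_approximable_closed)
  have [measurable]: "(\<lambda>t. complex_of_real (f t)) \<in> borel_measurable unit_interval"
    by (rule measurable_restrict_space1)
       (use borel_measurable_continuous_onI[OF f] in simp)
  have "compact (f ` {0..1})"
    by (intro compact_continuous_image continuous_on_subset[OF f]) auto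
  from compact_imp_bounded[OF this] obtain C where "\<forall>y\<in>f ` {0..1}. norm y \<le> C"
    by (auto simp only: bounded_iff)
  then have "\<And>t. t \<in> {0..1} \<Longrightarrow> norm (f t) \<le> C" by auto
  then show sP: "square_integrable_unit (\<lambda>t. complex_of_real (f t))"
    by (intro square_integrable_unit_bounded[where C = C]) auto
  fix \<epsilon> :: real assume e: "\<epsilon> > 0"
  then obtain N where N: "\<And>n x. N \<le> n \<Longrightarrow> x \<in> {0..1} \<Longrightarrow>
      \<bar>f x - (\<Sum>k\<le>n. f (k / n) * Bernstein n k x)\<bar> < sqrt (\<epsilon> / 2)"
    using Bernstein_Weierstrass[OF continuous_on_subset[OF f], of "sqrt (\<epsilon> / 2)"] by auto
  define Q where "Q t = (\<Sum>k\<le>N. f (k / N) * Bernstein N k t)" for t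
  have "bounded_trig_approximable (\<lambda>t. (\<Sum>k\<le>N. of_real (f (k / N)) *
     (of_real (of_nat (N choose k)) * (of_real t) ^ k * (1 + (-1) * of_real t) ^ (N - k))))"
    by (intro bounded_trig_approximable_sum bounded_trig_approximable_mult
          bounded_trig_approximable_power bounded_trig_approximable_identity
          bounded_trig_approximable_const bounded_trig_approximable_add)
  then have aQ: "trig_approximable (\<lambda>t. of_real (Q t))"
    by (simp add: Q_def Bernstein_def bounded_trig_approximable_def)
  then have sQ: "square_integrable_unit (\<lambda>t. complex_of_real (Q t))"
    by (simp add: trig_approximable_def)
  have le: "(cmod (of_real (f t) - of_real (Q t)))\<^sup>2 \<le> \<epsilon> / 2" if "0 \<le> t" "t < 1" for t
  proof -
    have "cmod (of_real (f t) - of_real (Q t)) \<le> sqrt (\<epsilon> / 2)"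
      using N[of N t] that by (simp add: Q_def flip: of_real_diff del: of_real_sum)
    then have "(cmod (of_real (f t) - of_real (Q t)))\<^sup>2 \<le> (sqrt (\<epsilon> / 2))\<^sup>2"
      by (intro power_mono) auto
    then show ?thesis using e by simp
  qed
  have "(LINT t|unit_interval. (cmod (of_real (f t) - of_real (Q t)))\<^sup>2) \<le> (LINT t|unit_interval. \<epsilon> / 2)"
    using square_integrable_unit_diff[OF sP sQ] le
    by (intro integral_mono) (auto simp: square_integrable_unit_def space_restrict_space)
  also have "\<dots> < \<epsilon>" using e by (simp add: space_restrict_space)
  finally show "\<exists>Q. trig_approximable Q \<and> (LINT t|unit_interval. (cmod (of_real (f t) - Q t))\<^sup>2) < \<epsilon>"
    using aQ by blast
qed

lemma trig_approximable_continuous: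
  assumes f: "continuous_on UNIV f"
  shows "trig_approximable f"
proof -
  have "trig_approximable (\<lambda>t. \<i> * character 0 t * of_real (Im (f t)))"
    by (intro trig_approximable_mult_character trig_approximable_continuous_real continuous_intros f)
  then have "trig_approximable (\<lambda>t. of_real (Re (f t)) + \<i> * of_real (Im (f t)))"
    by (intro trig_approximable_add trig_approximable_continuous_real continuous_intros f) simp
  then show ?thesis by (simp flip: complex_eq)
qed

text \<open>
  A measurable function is an almost everywhere limit of continuous functions. Projecting these to the
  ball of radius \<open>C\<close> keeps them continuous and makes the convergence dominated.
\<close>
lemma trig_approximable_bounded:
  assumes P: "P \<in> borel_measurable unit_interval"
    and C: "\<And>t. 0 \<le> t \<Longrightarrow> t < 1 \<Longrightarrow> cmod (P t) \<le> C"
  shows "trig_approximable P"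
proof (rule trig_approximable_closed)
  show sP: "square_integrable_unit P" by (rule square_integrable_unit_bounded[OF P C])
  have C0: "0 \<le> C" using C[of 0] norm_ge_zero[of "P 0"] by linarith
  have "P \<in> borel_measurable (restrict_space lebesgue {0..<1})"
    using P
    by (rule borel_measurable_subalgebra[rotated 2])
       (auto simp: space_restrict_space intro!: mono_restrict_space)
  then have "P measurable_on {0..<1}"
    by (subst measurable_on_iff_borel_measurable) auto
  then obtain N g where N: "negligible N" and g: "\<And>n. continuous_on UNIV (g n)"
    and lim: "\<And>x. x \<notin> N \<Longrightarrow> (\<lambda>n. g n x) \<longlonglongrightarrow> (if x \<in> {0..<1} then P x else 0)"
    unfolding measurable_on_def by metis
  \<comment> \<open>The nearest-point projection fixes the values of P and is continuous.\<close>
  define proj where "proj = closest_point (cball 0 C :: complex set)"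
  have cp: "continuous_on A proj" for A
    unfolding proj_def by (rule continuous_on_closest_point) (use C0 in auto)
  have pC: "cmod (proj z) \<le> C" for z
    using closest_point_in_set[of "cball 0 C" z] C0 by (simp add: proj_def)
  have pself: "proj z = z" if "cmod z \<le> C" for z
    unfolding proj_def by (rule closest_point_self) (use that in simp)
  define h where "h n t = proj (g n t)" for n t
  have h: "continuous_on UNIV (h n)" for n
    unfolding h_def using continuous_on_compose[OF g cp] by (simp add: o_def)
  have ah: "trig_approximable (h n)" for n by (rule trig_approximable_continuous[OF h])
  have [measurable]: "h n \<in> borel_measurable unit_interval" "P \<in> borel_measurable unit_interval" for n
    using ah[of n] P by (auto simp: trig_approximable_def square_integrable_unit_def)
  have "N \<in> null_sets lebesgue" using N by (simp add: negligible_iff_null_sets)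
  then have "AE x in lebesgue. x \<notin> N" by (rule AE_not_in)
  then have "AE x in lborel. x \<notin> N" by (simp add: AE_completion_iff)
  then have ae: "AE t in unit_interval. (\<lambda>n. h n t) \<longlonglongrightarrow> P t"
  proof (subst AE_restrict_space_iff, simp, eventually_elim, intro impI)
    fix t assume t: "t \<notin> N" "t \<in> {0..<1}"
    have "(\<lambda>n. proj (g n t)) \<longlonglongrightarrow> proj (P t)"
      using lim[OF t(1)] t(2) cp[of UNIV]
      by (intro continuous_on_tendsto_compose[OF cp[of UNIV]]) auto
    then show "(\<lambda>n. h n t) \<longlonglongrightarrow> P t" using C t by (simp add: h_def pself)
  qed
  have "(\<lambda>n. LINT t|unit_interval. (cmod (P t - h n t))\<^sup>2) \<longlonglongrightarrow> (LINT t|unit_interval. 0)"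
  proof (rule integral_dominated_convergence)
    show "integrable unit_interval (\<lambda>t. (2 * C)\<^sup>2)" by simp
    show "AE t in unit_interval. (\<lambda>n. (cmod (P t - h n t))\<^sup>2) \<longlonglongrightarrow> 0"
      using ae
    proof eventually_elim
      fix t assume "(\<lambda>n. h n t) \<longlonglongrightarrow> P t"
      then have "(\<lambda>n. (cmod (P t - h n t))\<^sup>2) \<longlonglongrightarrow> (cmod (P t - P t))\<^sup>2" by (intro tendsto_intros)
      then show "(\<lambda>n. (cmod (P t - h n t))\<^sup>2) \<longlonglongrightarrow> 0" by simp
    qed
    have "cmod (P t - h n t) \<le> 2 * C" if "0 \<le> t" "t < 1" for n t
      using norm_triangle_ineq4[of "P t" "h n t"] C[OF that] pC[of "g n t"] by (simp add: h_def)
    then have "(cmod (P t - h n t))\<^sup>2 \<le> (2 * C)\<^sup>2" if "0 \<le> t" "t < 1" for n t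
      using that by (intro power_mono) auto
    then show "AE t in unit_interval. norm ((cmod (P t - h n t))\<^sup>2) \<le> (2 * C)\<^sup>2" for n
      by (intro AE_I2) (simp add: space_restrict_space)
  qed auto
  then have lim0: "(\<lambda>n. LINT t|unit_interval. (cmod (P t - h n t))\<^sup>2) \<longlonglongrightarrow> 0" by simp
  fix \<epsilon> :: real assume "\<epsilon> > 0"
  then obtain n where "(LINT t|unit_interval. (cmod (P t - h n t))\<^sup>2) < \<epsilon>"
    using order_tendstoD(2)[OF lim0, of \<epsilon>] by (auto simp: eventually_sequentially)
  then show "\<exists>Q. trig_approximable Q \<and> (LINT t|unit_interval. (cmod (P t - Q t))\<^sup>2) < \<epsilon>"
    using ah by blast
qed

text \<open>
  Truncation of the large values reduces to the bounded case.
\<close>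
lemma trig_approximable_square_integrable:
  assumes sP: "square_integrable_unit P"
  shows "trig_approximable P"
proof (rule trig_approximable_closed[OF sP])
  from sP have [measurable]: "P \<in> borel_measurable unit_interval"
    and i: "integrable unit_interval (\<lambda>t. (cmod (P t))\<^sup>2)"
    by (auto simp: square_integrable_unit_def)
  define h where "h n t = (if cmod (P t) \<le> real n then P t else 0)" for n t
  have [measurable]: "h n \<in> borel_measurable unit_interval" for n
    unfolding h_def by measurable
  have ah: "trig_approximable (h n)" for n
    by (rule trig_approximable_bounded[where C = "real n"]) (auto simp: h_def)
  have "(\<lambda>n. LINT t|unit_interval. (cmod (P t - h n t))\<^sup>2) \<longlonglongrightarrow> (LINT t|unit_interval. 0)"
  proof (rule integral_dominated_convergence[OF _ _ i])
    show "AE t in unit_interval. (\<lambda>n. (cmod (P t - h n t))\<^sup>2) \<longlonglongrightarrow> 0"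
    proof (rule AE_I2)
      fix t
      have "\<forall>\<^sub>F n in sequentially. (cmod (P t - h n t))\<^sup>2 = 0"
        using eventually_ge_at_top[of "nat \<lceil>cmod (P t)\<rceil>"]
        by eventually_elim (auto simp: h_def nat_le_iff ceiling_le_iff)
      then show "(\<lambda>n. (cmod (P t - h n t))\<^sup>2) \<longlonglongrightarrow> 0" by (rule tendsto_eventually)
    qed
  qed (auto simp: h_def)
  then have lim0: "(\<lambda>n. LINT t|unit_interval. (cmod (P t - h n t))\<^sup>2) \<longlonglongrightarrow> 0" by simp
  fix \<epsilon> :: real assume "\<epsilon> > 0"
  then obtain n where "(LINT t|unit_interval. (cmod (P t - h n t))\<^sup>2) < \<epsilon>"
    using order_tendstoD(2)[OF lim0, of \<epsilon>] by (auto simp: eventually_sequentially)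
  then show "\<exists>Q. trig_approximable Q \<and> (LINT t|unit_interval. (cmod (P t - Q t))\<^sup>2) < \<epsilon>"
    using ah by blast
qed

text \<open>
  Bessel's inequality gives one bound; approximability gives the other, because the Fourier partial sum
  over a finite set of frequencies is at least as close to \<open>P\<close> as any other sum over that set.
\<close>
theorem parseval:
  assumes P: "square_integrable_unit P"
  shows "((\<lambda>m. (cmod (fourier_coeff P m))\<^sup>2) has_sum (LINT t|unit_interval. (cmod (P t))\<^sup>2)) UNIV"
proof -
  let ?c = "\<lambda>m. (cmod (fourier_coeff P m))\<^sup>2" and ?I = "LINT t|unit_interval. (cmod (P t))\<^sup>2"
  have le: "sum ?c F \<le> ?I" if F: "finite F" for F
  proof -
    have "0 \<le> (LINT t|unit_interval. (cmod (P t - trig_sum F (fourier_coeff P) t))\<^sup>2)" by simp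
    also have "\<dots> = ?I - sum ?c F" by (subst trig_sum_distance[OF P F]) simp
    finally show ?thesis by simp
  qed
  have s: "?c summable_on UNIV"
    by (rule nonneg_bounded_partial_sums_imp_summable_on[where C = ?I])
       (auto intro!: eventually_finite_subsets_at_top_weakI le)
  have "infsum ?c UNIV = ?I"
  proof (rule antisym)
    show "infsum ?c UNIV \<le> ?I" by (rule infsum_le_finite_sums[OF s le])
    show "?I \<le> infsum ?c UNIV"
    proof (rule field_le_epsilon)
      fix \<epsilon> :: real assume "\<epsilon> > 0"
      then obtain F d where F: "finite F" "(LINT t|unit_interval. (cmod (P t - trig_sum F d t))\<^sup>2) < \<epsilon>"
        using trig_approximable_square_integrable[OF P] unfolding trig_approximable_def by meson
      have "?I - sum ?c F \<le> (LINT t|unit_interval. (cmod (P t - trig_sum F d t))\<^sup>2)"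
        by (subst trig_sum_distance[OF P F(1)]) (simp add: sum_nonneg)
      moreover have "sum ?c F \<le> infsum ?c UNIV"
        by (rule finite_sum_le_infsum[OF s F(1)]) auto
      ultimately show "?I \<le> infsum ?c UNIV + \<epsilon>" using F(2) by linarith
    qed
  qed
  with s show ?thesis by (simp add: has_sum_iff)
qed

section \<open>Square-summable two-sided sequences\<close>

lemma has_sum_sum:
  fixes f :: "'a \<Rightarrow> 'b \<Rightarrow> 'c::topological_comm_monoid_add"
  assumes "\<And>i. i \<in> I \<Longrightarrow> (f i has_sum S i) A"
  shows "((\<lambda>x. \<Sum>i\<in>I. f i x) has_sum (\<Sum>i\<in>I. S i)) A"
  using assms by (induction I rule: infinite_finite_induct) (auto intro: has_sum_add)

definition ell2 :: "(int \<Rightarrow> complex) \<Rightarrow> bool"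
  where "ell2 x \<longleftrightarrow> (\<lambda>n. (cmod (x n))\<^sup>2) summable_on UNIV"

text \<open>
  The squared \<open>\<ell>\<^sup>2\<close>-norm.
\<close>
definition energy :: "(int \<Rightarrow> complex) \<Rightarrow> real"
  where "energy x = (\<Sum>\<^sub>\<infinity>n. (cmod (x n))\<^sup>2)"

lemma energy_nonneg [simp]: "0 \<le> energy x"
  unfolding energy_def by (rule infsum_nonneg) simp

lemma ell2_has_sum: "ell2 x \<Longrightarrow> ((\<lambda>n. (cmod (x n))\<^sup>2) has_sum energy x) UNIV"
  by (simp add: ell2_def energy_def)

lemma ell2I: "((\<lambda>n. (cmod (x n))\<^sup>2) has_sum E) UNIV \<Longrightarrow> ell2 x \<and> energy x = E"
  by (auto simp: ell2_def energy_def has_sum_iff)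

lemma ell2_sum_le_energy:
  assumes "ell2 x" "finite F" shows "(\<Sum>n\<in>F. (cmod (x n))\<^sup>2) \<le> energy x"
  unfolding energy_def using assms by (intro finite_sum_le_infsum) (auto simp: ell2_def)

lemma ell2_boundedI:
  assumes "\<And>F. finite F \<Longrightarrow> (\<Sum>n\<in>F. (cmod (x n))\<^sup>2) \<le> C"
  shows "ell2 x" and "energy x \<le> C"
proof -
  show "ell2 x" unfolding ell2_def
    by (rule nonneg_bounded_partial_sums_imp_summable_on[where C = C])
       (auto intro!: eventually_finite_subsets_at_top_weakI assms)
  then show "energy x \<le> C"
    unfolding energy_def ell2_def by (rule infsum_le_finite_sums) (rule assms)
qed

lemma ell2_cauchy_schwarz:
  assumes x: "ell2 x" and y: "ell2 y"
  shows "(\<lambda>n. cmod (x n * y n)) summable_on UNIV"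
    and "(\<Sum>\<^sub>\<infinity>n. cmod (x n * y n)) \<le> sqrt (energy x * energy y)"
proof -
  have le: "(\<Sum>n\<in>F. cmod (x n * y n)) \<le> sqrt (energy x * energy y)" if F: "finite F" for F
  proof -
    have "(\<Sum>n\<in>F. cmod (x n * y n)) = (\<Sum>n\<in>F. \<bar>cmod (x n)\<bar> * \<bar>cmod (y n)\<bar>)"
      by (simp add: norm_mult)
    also have "\<dots> \<le> L2_set (\<lambda>n. cmod (x n)) F * L2_set (\<lambda>n. cmod (y n)) F"
      by (rule L2_set_mult_ineq)
    also have "\<dots> \<le> sqrt (energy x) * sqrt (energy y)"
      unfolding L2_set_def
      by (intro mult_mono real_sqrt_le_mono ell2_sum_le_energy x y F) (auto intro!: sum_nonneg)
    finally show ?thesis by (simp add: real_sqrt_mult)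
  qed
  show s: "(\<lambda>n. cmod (x n * y n)) summable_on UNIV"
    by (rule nonneg_bounded_partial_sums_imp_summable_on[where C = "sqrt (energy x * energy y)"])
       (auto intro!: eventually_finite_subsets_at_top_weakI le)
  show "(\<Sum>\<^sub>\<infinity>n. cmod (x n * y n)) \<le> sqrt (energy x * energy y)"
    by (rule infsum_le_finite_sums[OF s le])
qed

lemma ell2_mult_summable:
  assumes "ell2 x" "ell2 y" shows "(\<lambda>n. x n * y n) summable_on UNIV"
  by (rule abs_summable_summable) (rule ell2_cauchy_schwarz(1)[OF assms])

lemma ell2_mult_infsum_le:
  assumes "ell2 x" "ell2 y" shows "cmod (\<Sum>\<^sub>\<infinity>n. x n * y n) \<le> sqrt (energy x * energy y)"
  using norm_infsum_bound[OF ell2_cauchy_schwarz(1)[OF assms]] ell2_cauchy_schwarz(2)[OF assms]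
  by linarith

lemma ell2_cnj [simp]: "ell2 (\<lambda>n. cnj (x n)) \<longleftrightarrow> ell2 x" "energy (\<lambda>n. cnj (x n)) = energy x"
  by (simp_all add: ell2_def energy_def)

lemma ell2_cmult:
  assumes "ell2 x" shows "ell2 (\<lambda>n. c * x n) \<and> energy (\<lambda>n. c * x n) = (cmod c)\<^sup>2 * energy x"
  by (rule ell2I) (use has_sum_cmult_right[OF ell2_has_sum[OF assms], of "(cmod c)\<^sup>2"]
      in \<open>simp add: norm_mult power_mult_distrib\<close>)

lemma ell2_reindex:
  assumes x: "ell2 x" and b: "bij h"
  shows "ell2 (\<lambda>n. x (h n)) \<and> energy (\<lambda>n. x (h n)) = energy x"
  using ell2_has_sum[OF x] by (intro ell2I) (subst has_sum_reindex_bij_betw[OF b])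

lemma bij_int_diff: "bij (\<lambda>n::int. k - n)" "bij (\<lambda>n::int. n - k)" "bij (\<lambda>n::int. n + k)" "bij (\<lambda>n::int. k + n)"
proof -
  show "bij (\<lambda>n::int. k - n)" by (rule bij_betw_byWitness[where f' = "\<lambda>n. k - n"]) auto
  show "bij (\<lambda>n::int. n - k)" by (rule bij_betw_byWitness[where f' = "\<lambda>n. n + k"]) auto
  show "bij (\<lambda>n::int. n + k)" by (rule bij_betw_byWitness[where f' = "\<lambda>n. n - k"]) auto
  show "bij (\<lambda>n::int. k + n)" by (rule bij_betw_byWitness[where f' = "\<lambda>n. n - k"]) auto
qed

lemma ell2_shift:
  assumes "ell2 x"
  shows "ell2 (\<lambda>n. x (k - n))" "ell2 (\<lambda>n. x (n - k))" "ell2 (\<lambda>n. x (n + k))" "ell2 (\<lambda>n. x (k + n))"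
    "energy (\<lambda>n. x (k - n)) = energy x" "energy (\<lambda>n. x (n - k)) = energy x"
    "energy (\<lambda>n. x (n + k)) = energy x" "energy (\<lambda>n. x (k + n)) = energy x"
  using bij_int_diff[of k, THEN ell2_reindex[OF assms]] by auto

lemma parallelogram: "(cmod (x + y))\<^sup>2 + (cmod (x - y))\<^sup>2 = 2 * (cmod x)\<^sup>2 + 2 * (cmod y)\<^sup>2"
  by (simp add: cmod_power2 power2_sum power2_diff)

lemma ell2_add:
  assumes x: "ell2 x" and y: "ell2 y"
  shows "ell2 (\<lambda>n. x n + y n)"
proof (rule ell2_boundedI(1))
  fix F :: "int set" assume F: "finite F"
  have "(\<Sum>n\<in>F. (cmod (x n + y n))\<^sup>2) \<le> (\<Sum>n\<in>F. 2 * (cmod (x n))\<^sup>2 + 2 * (cmod (y n))\<^sup>2)"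
    by (intro sum_mono cmod_add_sq_le)
  also have "\<dots> \<le> 2 * energy x + 2 * energy y"
    using ell2_sum_le_energy[OF x F] ell2_sum_le_energy[OF y F]
    by (simp add: sum.distrib flip: sum_distrib_left)
  finally show "(\<Sum>n\<in>F. (cmod (x n + y n))\<^sup>2) \<le> 2 * energy x + 2 * energy y" .
qed

lemma ell2_diff:
  assumes x: "ell2 x" and y: "ell2 y" shows "ell2 (\<lambda>n. x n - y n)"
  using ell2_add[OF x conjunct1[OF ell2_cmult[OF y, of "-1"]]] by simp

lemma energy_parallelogram:
  assumes x: "ell2 x" and y: "ell2 y"
  shows "energy (\<lambda>n. x n + y n) + energy (\<lambda>n. x n - y n) = 2 * energy x + 2 * energy y"
proof -
  have "((\<lambda>n. (cmod (x n + y n))\<^sup>2 + (cmod (x n - y n))\<^sup>2) has_sum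
      energy (\<lambda>n. x n + y n) + energy (\<lambda>n. x n - y n)) UNIV"
    by (intro has_sum_add ell2_has_sum ell2_add ell2_diff x y)
  moreover have "((\<lambda>n. 2 * (cmod (x n))\<^sup>2 + 2 * (cmod (y n))\<^sup>2) has_sum 2 * energy x + 2 * energy y) UNIV"
    by (intro has_sum_add has_sum_cmult_right ell2_has_sum x y)
  ultimately show ?thesis unfolding parallelogram by (rule has_sum_unique)
qed

lemma energy_finite_support:
  assumes F: "finite F" and x: "\<And>n. n \<notin> F \<Longrightarrow> x n = 0"
  shows "ell2 x" "energy x = (\<Sum>n\<in>F. (cmod (x n))\<^sup>2)"
proof -
  have "((\<lambda>n. (cmod (x n))\<^sup>2) has_sum (\<Sum>n\<in>F. (cmod (x n))\<^sup>2)) UNIV"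
    by (rule has_sum_finite_neutralI[OF F]) (auto simp: x)
  then show "ell2 x" "energy x = (\<Sum>n\<in>F. (cmod (x n))\<^sup>2)" using ell2I by blast+
qed

text \<open>
  Finitely supported sequences are dense in \<open>\<ell>\<^sup>2\<close>.
\<close>
lemma energy_tail_small:
  assumes x: "ell2 x" and e: "\<epsilon> > 0"
  obtains F where "finite F" "ell2 (\<lambda>n. if n \<in> F then 0 else x n)"
    "energy (\<lambda>n. if n \<in> F then 0 else x n) \<le> \<epsilon>"
proof -
  obtain F where F: "finite F" and le: "dist (\<Sum>n\<in>F. (cmod (x n))\<^sup>2) (energy x) \<le> \<epsilon>"
    using infsum_finite_approximation[of "\<lambda>n. (cmod (x n))\<^sup>2" UNIV \<epsilon>] x e
    unfolding ell2_def energy_def by auto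
  have "(\<Sum>n\<in>E. (cmod (if n \<in> F then 0 else x n))\<^sup>2) \<le> \<epsilon>" if E: "finite E" for E
  proof -
    have "(\<Sum>n\<in>E. (cmod (if n \<in> F then 0 else x n))\<^sup>2) = (\<Sum>n\<in>E - F. (cmod (x n))\<^sup>2)"
      using E by (intro sum.mono_neutral_cong_right) auto
    also have "\<dots> = (\<Sum>n\<in>F \<union> E. (cmod (x n))\<^sup>2) - (\<Sum>n\<in>F. (cmod (x n))\<^sup>2)"
      using E F sum.union_disjoint[of F "E - F" "\<lambda>n. (cmod (x n))\<^sup>2"] by auto
    also have "\<dots> \<le> \<epsilon>"
      using ell2_sum_le_energy[OF x, of "F \<union> E"] E F le by (auto simp: dist_real_def)
    finally show ?thesis .
  qed
  from ell2_boundedI[OF this] that[OF F] show thesis by blast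
qed

section \<open>The discrete Hilbert transform\<close>

definition square_wave :: "real \<Rightarrow> complex"
  where "square_wave t = (if t < 1 / 2 then 1 else - 1)"

definition hilbert_kernel :: "int \<Rightarrow> complex"
  where "hilbert_kernel n = (if odd n then 2 / (\<i> * pi * of_int n) else 0)"

lemma measurable_square_wave [measurable]: "square_wave \<in> borel_measurable unit_interval"
  unfolding square_wave_def by (rule measurable_restrict_space1) simp

lemma norm_square_wave [simp]: "cmod (square_wave t) = 1"
  by (simp add: square_wave_def)

text \<open>
  This ties the sequence-side kernel to a function of modulus \<open>1\<close>.
\<close>
lemma fourier_coeff_square_wave: "fourier_coeff square_wave n = hilbert_kernel n"
proof -
  let ?e = "character (- n)"
  have meas: "(\<lambda>t. if t < 1 / 2 then ?e t else 0) \<in> borel_measurable unit_interval"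
    by (rule measurable_restrict_space1) simp
  have int: "integrable unit_interval (\<lambda>t. if t < 1 / 2 then ?e t else 0)"
    by (rule integrable_unit_interval_bounded[OF meas, where C = 1]) simp
  have "fourier_coeff square_wave n = (LINT t|unit_interval. 2 * (if t < 1 / 2 then ?e t else 0) - ?e t)"
    unfolding fourier_coeff_def
    by (rule Bochner_Integration.integral_cong) (auto simp: square_wave_def cnj_character)
  also have "\<dots> = 2 * (LINT t|unit_interval. (if t < 1 / 2 then ?e t else 0)) - (if n = 0 then 1 else 0)"
    using int by (simp add: integral_character)
  also have "\<dots> = hilbert_kernel n"
  proof (cases "n = 0")
    case True
    have I: "(LINT t|unit_interval. (if t < 1 / 2 then ?e t else 0)) = of_real (1 / 2) - of_real 0"
      by (rule integral_unit_interval_FTC_upto)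
         (auto simp: True intro!: continuous_intros has_vector_derivative_of_real derivative_eq_intros)
    show ?thesis unfolding I by (simp add: True hilbert_kernel_def)
  next
    case False
    define w :: complex where "w = 2 * pi * \<i> * of_int (- n)"
    have w: "w \<noteq> 0" using False by (simp add: w_def)
    have "((\<lambda>t. ?e t / w) has_vector_derivative ?e t) (at t)" for t
      using has_vector_derivative_divide[OF has_vector_derivative_character[of "- n" t], of w]
      by (simp only: w_def[symmetric] nonzero_mult_div_cancel_left[OF w])
    then have I: "(LINT t|unit_interval. (if t < 1 / 2 then ?e t else 0)) = ?e (1 / 2) / w - ?e 0 / w"
      by (rule integral_unit_interval_FTC_upto) (auto intro!: continuous_intros)
    have "?e (1 / 2) = cnj (cis (pi * of_int n))"
      by (simp add: character_def cis_cnj)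
    also have "cis (pi * of_int n) = (if even n then 1 else - 1)"
    proof (cases "even n")
      case True
      then obtain k where k: "n = 2 * k" by (elim evenE)
      have "cis (2 * pi * of_int k) = 1" by (rule cis_multiple_2pi) simp
      then show ?thesis using True by (simp add: k mult_ac)
    next
      case False
      then obtain k where k: "n = 2 * k + 1" by (elim oddE)
      have "pi * of_int n = 2 * pi * of_int k + pi" by (simp add: k distrib_left)
      then have "cis (pi * of_int n) = cis (2 * pi * of_int k) * cis pi" by (simp only: cis_mult)
      also have "cis (2 * pi * of_int k) = 1" by (rule cis_multiple_2pi) simp
      finally show ?thesis using False by simp
    qed
    finally have "?e (1 / 2) = (if even n then 1 else - 1)" by simp
    then show ?thesis unfolding I using False
      by (simp add: hilbert_kernel_def w_def divide_simps)
  qed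
  finally show ?thesis .
qed

lemma cnj_hilbert_kernel: "cnj (hilbert_kernel n) = hilbert_kernel (- n)"
  by (simp add: hilbert_kernel_def)

lemma hilbert_kernel_decay: "\<bar>of_int n\<bar> * cmod (hilbert_kernel n) \<le> 1"
  using pi_ge_two by (auto simp: hilbert_kernel_def norm_divide norm_mult field_simps)

lemma hilbert_kernel_0 [simp]: "hilbert_kernel 0 = 0"
  by (simp add: hilbert_kernel_def)

lemma ell2_hilbert_kernel: "ell2 hilbert_kernel" "energy hilbert_kernel = 1"
proof -
  have "((\<lambda>m. (cmod (fourier_coeff square_wave m))\<^sup>2) has_sum
      (LINT t|unit_interval. (cmod (square_wave t))\<^sup>2)) UNIV"
    by (intro parseval square_integrable_unit_bounded[where C = 1]) auto
  then have "((\<lambda>m. (cmod (hilbert_kernel m))\<^sup>2) has_sum 1) UNIV"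
    by (simp add: fourier_coeff_square_wave space_restrict_space)
  then show "ell2 hilbert_kernel" "energy hilbert_kernel = 1" using ell2I by blast+
qed

definition hilbert :: "(int \<Rightarrow> complex) \<Rightarrow> int \<Rightarrow> complex"
  where "hilbert x n = (\<Sum>\<^sub>\<infinity>j. hilbert_kernel (n - j) * x j)"

lemma hilbert_summable: "ell2 x \<Longrightarrow> (\<lambda>j. hilbert_kernel (n - j) * x j) summable_on UNIV"
  by (intro ell2_mult_summable ell2_shift ell2_hilbert_kernel)

text \<open>
  The sum over \<open>F\<close> is a Fourier coefficient of a trigonometric polynomial times the square wave;
  multiplication by the square wave does not change the modulus.
\<close>
lemma hilbert_finite_isometry:
  assumes F: "finite F"
  shows "((\<lambda>n. (cmod (\<Sum>j\<in>F. hilbert_kernel (n - j) * x j))\<^sup>2) has_sum (\<Sum>j\<in>F. (cmod (x j))\<^sup>2)) UNIV"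
proof -
  let ?X = "trig_sum F x"
  have coeff: "fourier_coeff (\<lambda>t. ?X t * square_wave t) n = (\<Sum>j\<in>F. hilbert_kernel (n - j) * x j)" for n
  proof -
    have "?X t * square_wave t * cnj (character n t)
        = (\<Sum>j\<in>F. x j * (square_wave t * cnj (character (n - j) t)))" for t
      by (simp add: trig_sum_def sum_distrib_left sum_distrib_right cnj_character
          mult_ac character_mult[symmetric] flip: add_uminus_conv_diff)
    moreover have "integrable unit_interval (\<lambda>t. square_wave t * cnj (character (n - j) t))" for j
      by (rule integrable_unit_interval_bounded[where C = 1]) (auto simp: norm_mult)
    ultimately show ?thesis
      by (simp add: fourier_coeff_def fourier_coeff_square_wave[symmetric] mult.commute)
  qed
  have sX: "square_integrable_unit (\<lambda>t. ?X t * square_wave t)"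
    by (rule square_integrable_unit_mult_bounded(1)[OF square_integrable_unit_trig_sum, where C = 1]) auto
  have "(LINT t|unit_interval. (cmod (?X t * square_wave t))\<^sup>2)
      = (LINT t|unit_interval. (cmod (0 - ?X t))\<^sup>2)"
    by (simp add: norm_mult)
  also have "\<dots> = (\<Sum>j\<in>F. (cmod (x j))\<^sup>2)"
    using trig_sum_distance[of "\<lambda>_. 0" F x, OF _ F]
    by (simp add: fourier_coeff_def square_integrable_unit_def)
  finally show ?thesis
    using parseval[OF sX] by (simp add: coeff)
qed

lemma hilbert_finite_support:
  assumes "finite F" "\<And>n. n \<notin> F \<Longrightarrow> x n = 0"
  shows "hilbert x n = (\<Sum>j\<in>F. hilbert_kernel (n - j) * x j)"
  unfolding hilbert_def
  by (rule infsumI, rule has_sum_finite_neutralI) (use assms in auto)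

lemma hilbert_add:
  assumes "ell2 x" "ell2 y"
  shows "hilbert (\<lambda>n. x n + y n) n = hilbert x n + hilbert y n"
  unfolding hilbert_def distrib_left
  by (intro infsum_add hilbert_summable assms)

lemma hilbert_diff:
  assumes "ell2 x" "ell2 y"
  shows "hilbert (\<lambda>n. x n - y n) n = hilbert x n - hilbert y n"
proof -
  have "hilbert (\<lambda>n. (x n - y n) + y n) n = hilbert (\<lambda>n. x n - y n) n + hilbert y n"
    by (intro hilbert_add ell2_diff assms)
  then show ?thesis by simp
qed

text \<open>
  Fatou's argument: a finite part of the energy of the image is a limit of the same part for
  truncated sequences, where the isometry is known.
\<close>
lemma hilbert_bounded:
  assumes x: "ell2 x"
  shows "ell2 (hilbert x)" "energy (hilbert x) \<le> energy x"
proof -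
  have "(\<Sum>n\<in>E. (cmod (hilbert x n))\<^sup>2) \<le> energy x" if E: "finite E" for E
  proof (rule tendsto_upperbound)
    show "((\<lambda>F. \<Sum>n\<in>E. (cmod (\<Sum>j\<in>F. hilbert_kernel (n - j) * x j))\<^sup>2) \<longlongrightarrow>
        (\<Sum>n\<in>E. (cmod (hilbert x n))\<^sup>2)) (finite_subsets_at_top UNIV)"
      unfolding hilbert_def by (intro tendsto_intros infsum_tendsto hilbert_summable x)
    show "\<forall>\<^sub>F F in finite_subsets_at_top UNIV.
        (\<Sum>n\<in>E. (cmod (\<Sum>j\<in>F. hilbert_kernel (n - j) * x j))\<^sup>2) \<le> energy x"
    proof (intro eventually_finite_subsets_at_top_weakI)
      fix F :: "int set" assume F: "finite F"
      have "(\<Sum>n\<in>E. (cmod (\<Sum>j\<in>F. hilbert_kernel (n - j) * x j))\<^sup>2) \<le> (\<Sum>j\<in>F. (cmod (x j))\<^sup>2)"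
        by (rule finite_sum_le_has_sum[OF hilbert_finite_isometry[OF F] E]) auto
      also have "\<dots> \<le> energy x" by (rule ell2_sum_le_energy[OF x F])
      finally show "(\<Sum>n\<in>E. (cmod (\<Sum>j\<in>F. hilbert_kernel (n - j) * x j))\<^sup>2) \<le> energy x" .
    qed
  qed simp
  note bd = this
  show "ell2 (hilbert x)" by (rule ell2_boundedI(1)[OF bd])
  show "energy (hilbert x) \<le> energy x" by (rule ell2_boundedI(2)[OF bd])
qed

text \<open>
  Only the lower bound is new. Let \<open>u\<close> be a truncation of \<open>x\<close> and \<open>v = x - u\<close>. As the supports are
  disjoint, \<open>u - v\<close> has the same energy as \<open>x = u + v\<close>, so the known upper bound for \<open>u - v\<close> and the
  parallelogram law bound the energy of the image of \<open>x\<close> from below by \<open>2 energy u - energy x\<close>.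
\<close>
lemma hilbert_isometry:
  assumes x: "ell2 x"
  shows "energy (hilbert x) = energy x"
proof (rule antisym)
  show "energy (hilbert x) \<le> energy x" by (rule hilbert_bounded[OF x])
  have "(\<Sum>n\<in>F. (cmod (x n))\<^sup>2) \<le> (energy (hilbert x) + energy x) / 2" if F: "finite F" for F
  proof -
    define u where "u n = (if n \<in> F then x n else 0)" for n
    define v where "v n = x n - u n" for n
    have u: "ell2 u" "energy u = (\<Sum>n\<in>F. (cmod (x n))\<^sup>2)"
      using energy_finite_support[OF F, of u] by (auto simp: u_def)
    have v: "ell2 v" unfolding v_def by (rule ell2_diff[OF x u(1)])
    have "(cmod (u n - v n))\<^sup>2 = (cmod (x n))\<^sup>2" for n by (simp add: u_def v_def)
    then have uv: "energy (\<lambda>n. u n - v n) = energy x" by (simp add: energy_def)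
    have "hilbert u = (\<lambda>n. \<Sum>j\<in>F. hilbert_kernel (n - j) * x j)"
      using hilbert_finite_support[OF F, of u] by (auto simp: u_def fun_eq_iff)
    then have "energy (hilbert u) = energy u"
      using ell2I[OF hilbert_finite_isometry[OF F, of x]] u(2) by simp
    then have "2 * energy u \<le> 2 * energy (hilbert u) + 2 * energy (hilbert v)" by simp
    also have "\<dots> = energy (\<lambda>n. hilbert u n + hilbert v n) + energy (\<lambda>n. hilbert u n - hilbert v n)"
      by (intro energy_parallelogram[symmetric] hilbert_bounded u v)
    also have "\<dots> = energy (hilbert (\<lambda>n. u n + v n)) + energy (hilbert (\<lambda>n. u n - v n))"
      by (intro arg_cong2[where f = "\<lambda>a b. energy a + energy b"] ext
            hilbert_add[symmetric] hilbert_diff[symmetric] u v)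
    also have "energy (hilbert (\<lambda>n. u n + v n)) = energy (hilbert x)"
      by (simp add: v_def)
    also have "energy (hilbert (\<lambda>n. u n - v n)) \<le> energy x"
      using hilbert_bounded(2)[OF ell2_diff[OF u(1) v]] uv by simp
    finally show ?thesis using u(2) by simp
  qed
  then have "energy x \<le> (energy (hilbert x) + energy x) / 2"
    by (rule ell2_boundedI(2))
  then show "energy x \<le> energy (hilbert x)" by simp
qed

section \<open>Uniform boundedness of the symmetric partial sums\<close>

text \<open>
  For \<open>x = y\<close> this is a Fourier coefficient of the squared modulus of the function with Fourier
  coefficients \<open>x\<close>.
\<close>
definition correlation :: "(int \<Rightarrow> complex) \<Rightarrow> (int \<Rightarrow> complex) \<Rightarrow> int \<Rightarrow> complex"
  where "correlation x y k = (\<Sum>\<^sub>\<infinity>n. x (n - k) * cnj (y n))"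

lemma correlation_has_sum:
  assumes "ell2 x" "ell2 y"
  shows "((\<lambda>n. x (n - k) * cnj (y n)) has_sum correlation x y k) UNIV"
  unfolding correlation_def
  by (intro has_sum_infsum ell2_mult_summable ell2_shift) (use assms in auto)

lemma correlation_bound:
  assumes "ell2 x" "ell2 y"
  shows "cmod (correlation x y k) \<le> sqrt (energy x * energy y)"
  using ell2_mult_infsum_le[OF ell2_shift(2)[OF assms(1), of k], of "\<lambda>n. cnj (y n)"] assms
  by (simp add: correlation_def ell2_shift)

lemma correlation_add_right:
  assumes "ell2 x" "ell2 y" "ell2 z"
  shows "correlation x (\<lambda>n. y n + z n) k = correlation x y k + correlation x z k"
proof -
  have "((\<lambda>n. x (n - k) * cnj (y n) + x (n - k) * cnj (z n)) has_sum
      correlation x y k + correlation x z k) UNIV"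
    by (intro has_sum_add correlation_has_sum assms)
  then show ?thesis by (auto simp: correlation_def distrib_left intro!: infsumI)
qed

lemma correlation_uminus:
  assumes "ell2 x"
  shows "correlation x x (- k) = cnj (correlation x x k)"
proof -
  have "((\<lambda>n. cnj (x (n - k) * cnj (x n))) has_sum cnj (correlation x x k)) UNIV"
    by (simp only: has_sum_cnj_iff) (rule correlation_has_sum[OF assms assms])
  then have "((\<lambda>n. cnj (x (n + k - k) * cnj (x (n + k)))) has_sum cnj (correlation x x k)) UNIV"
    by (subst has_sum_reindex_bij_betw[OF bij_int_diff(3)])
  then show ?thesis by (auto simp: correlation_def mult.commute intro!: infsumI)
qed

text \<open>
  The sesquilinear form of the convolution operator whose kernel is truncated to \<open>{-K..K}\<close>.
\<close>
definition hilbert_partial :: "(int \<Rightarrow> complex) \<Rightarrow> (int \<Rightarrow> complex) \<Rightarrow> nat \<Rightarrow> complex"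
  where "hilbert_partial x y K = (\<Sum>k = - int K..int K. hilbert_kernel k * correlation x y k)"

text \<open>
  The left-hand side sums over all pairs of points of a window of length \<open>N\<close>; the difference \<open>k\<close> occurs
  \<open>N - |k|\<close> times. Enlarging the window by one point adds each \<open>k\<close> in \<open>{-N..N}\<close> once, which is the
  induction step.
\<close>
lemma toeplitz_sum_eq_cesaro:
  fixes c :: "int \<Rightarrow> 'a::comm_ring_1"
  shows "(\<Sum>i<N. \<Sum>i'<N. c (int i - int i')) = (\<Sum>k = - int N..int N. of_int (int N - \<bar>k\<bar>) * c k)"
proof (induction N)
  case 0
  then show ?case by simp
next
  case (Suc N)
  have row: "(\<Sum>i<N. c (int i - int N)) + (\<Sum>i'<N. c (int N - int i')) + c 0 = (\<Sum>k = - int N..int N. c k)"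
  proof -
    have "(\<Sum>i<N. c (int i - int N)) = (\<Sum>k\<in>{- int N..<0}. c k)"
      by (rule sum.reindex_bij_witness[of _ "\<lambda>k. nat (k + int N)" "\<lambda>i. int i - int N"]) auto
    moreover have "(\<Sum>i'<N. c (int N - int i')) = (\<Sum>k\<in>{0<..int N}. c k)"
      by (rule sum.reindex_bij_witness[of _ "\<lambda>k. nat (int N - k)" "\<lambda>i. int N - int i"]) auto
    moreover have "{- int N..int N} = insert 0 ({- int N..<0} \<union> {0<..int N})" by auto
    then have "(\<Sum>k = - int N..int N. c k) = c 0 + ((\<Sum>k\<in>{- int N..<0}. c k) + (\<Sum>k\<in>{0<..int N}. c k))"
      by (simp add: sum.union_disjoint disjoint_iff)
    ultimately show ?thesis by (simp add: algebra_simps)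
  qed
  have "(\<Sum>i<Suc N. \<Sum>i'<Suc N. c (int i - int i'))
      = (\<Sum>i<N. \<Sum>i'<N. c (int i - int i'))
        + ((\<Sum>i<N. c (int i - int N)) + (\<Sum>i'<N. c (int N - int i')) + c 0)"
    by (simp add: sum.distrib algebra_simps)
  also have "\<dots> = (\<Sum>k = - int N..int N. of_int (int N - \<bar>k\<bar>) * c k + c k)"
    by (simp only: row Suc.IH sum.distrib)
  also have "\<dots> = (\<Sum>k = - int N..int N. of_int (int (Suc N) - \<bar>k\<bar>) * c k)"
    by (rule sum.cong) (auto simp: algebra_simps)
  also have "\<dots> = (\<Sum>k = - int (Suc N)..int (Suc N). of_int (int (Suc N) - \<bar>k\<bar>) * c k)"
  proof (intro sum.mono_neutral_left ballI)
    fix k assume "k \<in> {- int (Suc N)..int (Suc N)} - {- int N..int N}"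
    then have "\<bar>k\<bar> = int (Suc N)" by auto
    then show "of_int (int (Suc N) - \<bar>k\<bar>) * c k = 0" by simp
  qed auto
  finally show ?case .
qed

text \<open>
  By the previous identity this bounds the Cesaro means. Restrict \<open>x\<close> and \<open>y\<close> to a window
  \<open>{p..<p + N}\<close> and apply the form of the isometry; the result \<open>T p\<close> is at most the product of the
  norms \<open>w x p\<close> and \<open>w y p\<close> of the restrictions. Summing over \<open>p\<close> recovers the correlations on the
  left, and on the right every entry is counted \<open>N\<close> times.
\<close>
lemma hilbert_window_sum_bound:
  assumes x: "ell2 x" and y: "ell2 y"
  shows "cmod (\<Sum>i<N. \<Sum>i'<N. hilbert_kernel (int i - int i') * correlation x y (int i - int i'))
     \<le> real N * sqrt (energy x * energy y)"
proof -
  define w where "w z p = complex_of_real (sqrt (\<Sum>i<N. (cmod (z (p + int i)))\<^sup>2))" for z :: "int \<Rightarrow> complex" and p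
  have w: "ell2 (w z) \<and> energy (w z) = real N * energy z" if z: "ell2 z" for z
  proof (rule ell2I)
    have "((\<lambda>p. \<Sum>i<N. (cmod (z (p + int i)))\<^sup>2) has_sum (\<Sum>i<N. energy z)) UNIV"
      using ell2_has_sum[OF ell2_shift(3)[OF z]] by (intro has_sum_sum) (simp_all add: ell2_shift[OF z])
    then show "((\<lambda>p. (cmod (w z p))\<^sup>2) has_sum real N * energy z) UNIV"
      by (simp add: w_def sum_nonneg)
  qed
  define T where "T p = (\<Sum>i<N. \<Sum>i'<N. hilbert_kernel (int i - int i') * (x (p + int i') * cnj (y (p + int i))))" for p
  have T_le: "cmod (T p) \<le> cmod (w x p * w y p)" for p
  proof -
    let ?W = "(\<lambda>i. p + int i) ` {..<N}"
    have inj: "inj_on (\<lambda>i. p + int i) {..<N}" by (auto simp: inj_on_def)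
    let ?S = "\<lambda>n. \<Sum>j\<in>?W. hilbert_kernel (n - j) * x j"
    have "T p = (\<Sum>i<N. cnj (y (p + int i)) * ?S (p + int i))"
      by (simp add: T_def sum.reindex[OF inj] sum_distrib_left mult_ac)
    also have "cmod \<dots> \<le> (\<Sum>i<N. \<bar>cmod (y (p + int i))\<bar> * \<bar>cmod (?S (p + int i))\<bar>)"
      by (rule order_trans[OF norm_sum]) (simp add: norm_mult)
    also have "\<dots> \<le> L2_set (\<lambda>i. cmod (y (p + int i))) {..<N} * L2_set (\<lambda>i. cmod (?S (p + int i))) {..<N}"
      by (rule L2_set_mult_ineq)
    also have "\<dots> \<le> L2_set (\<lambda>i. cmod (y (p + int i))) {..<N} * L2_set (\<lambda>i. cmod (x (p + int i))) {..<N}"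
      unfolding L2_set_def
    proof (intro mult_left_mono real_sqrt_le_mono)
      have "(\<Sum>i<N. (cmod (?S (p + int i)))\<^sup>2) = (\<Sum>n\<in>?W. (cmod (?S n))\<^sup>2)"
        by (simp add: sum.reindex[OF inj])
      also have "\<dots> \<le> (\<Sum>j\<in>?W. (cmod (x j))\<^sup>2)"
        by (rule finite_sum_le_has_sum[OF hilbert_finite_isometry]) auto
      finally show "(\<Sum>i<N. (cmod (?S (p + int i)))\<^sup>2) \<le> (\<Sum>i<N. (cmod (x (p + int i)))\<^sup>2)"
        by (simp add: sum.reindex[OF inj])
    qed (simp add: sum_nonneg)
    also have "\<dots> = cmod (w x p * w y p)"
      by (simp add: w_def norm_mult L2_set_def sum_nonneg)
    finally show ?thesis .
  qed
  have T_sum: "(T has_sum (\<Sum>i<N. \<Sum>i'<N. hilbert_kernel (int i - int i') * correlation x y (int i - int i'))) UNIV"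
    unfolding T_def
  proof (rule has_sum_sum, rule has_sum_sum, rule has_sum_cmult_right)
    fix i i' :: nat
    have "((\<lambda>p. x ((p + int i) - (int i - int i')) * cnj (y (p + int i))) has_sum
        correlation x y (int i - int i')) UNIV"
      using correlation_has_sum[OF x y] by (subst has_sum_reindex_bij_betw[OF bij_int_diff(3)])
    then show "((\<lambda>p. x (p + int i') * cnj (y (p + int i))) has_sum correlation x y (int i - int i')) UNIV"
      by simp
  qed
  have wxy: "ell2 (w x)" "ell2 (w y)" using w x y by blast+
  have "cmod (\<Sum>i<N. \<Sum>i'<N. hilbert_kernel (int i - int i') * correlation x y (int i - int i'))
      \<le> (\<Sum>\<^sub>\<infinity>p. cmod (w x p * w y p))"
    by (rule norm_infsum_le[OF T_sum has_sum_infsum[OF ell2_cauchy_schwarz(1)[OF wxy]] T_le])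
  also have "\<dots> \<le> sqrt (energy (w x) * energy (w y))"
    by (rule ell2_cauchy_schwarz(2)[OF wxy])
  also have "\<dots> = real N * sqrt (energy x * energy y)"
    using w[OF x] w[OF y] by (simp add: real_sqrt_mult)
  finally show ?thesis .
qed

text \<open>
  \<open>K\<close> times the partial sum is the Cesaro sum plus the sum of \<open>|k|\<close> times the \<open>k\<close>-th term. The decay
  of the kernel bounds each of the latter \<open>2 K + 1\<close> terms by a constant.
\<close>
lemma hilbert_partial_bound:
  assumes x: "ell2 x" and y: "ell2 y"
  shows "cmod (hilbert_partial x y K) \<le> 4 * sqrt (energy x * energy y)"
proof (cases "K = 0")
  case True
  then show ?thesis by (simp add: hilbert_partial_def)
next
  case False
  let ?M = "sqrt (energy x * energy y)"
  let ?c = "\<lambda>k. hilbert_kernel k * correlation x y k"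
  have "of_nat K * hilbert_partial x y K = (\<Sum>k = - int K..int K. of_int (int K - \<bar>k\<bar>) * ?c k)
      + (\<Sum>k = - int K..int K. of_int \<bar>k\<bar> * ?c k)"
    by (simp add: hilbert_partial_def sum_distrib_left algebra_simps flip: sum.distrib)
  moreover have "cmod (\<Sum>k = - int K..int K. of_int (int K - \<bar>k\<bar>) * ?c k) \<le> real K * ?M"
    unfolding toeplitz_sum_eq_cesaro[symmetric] by (rule hilbert_window_sum_bound[OF x y])
  moreover have "cmod (\<Sum>k = - int K..int K. of_int \<bar>k\<bar> * ?c k) \<le> (\<Sum>k = - int K..int K. ?M)"
  proof (rule sum_norm_le)
    fix k
    have "cmod (of_int \<bar>k\<bar> * ?c k) = (\<bar>of_int k\<bar> * cmod (hilbert_kernel k)) * cmod (correlation x y k)"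
      by (simp add: norm_mult)
    also have "\<dots> \<le> 1 * ?M"
      by (intro mult_mono hilbert_kernel_decay correlation_bound x y) auto
    finally show "cmod (of_int \<bar>k\<bar> * ?c k) \<le> ?M" by simp
  qed
  \<comment> \<open>There are 2 K + 1 terms, at most 3 K as K is positive.\<close>
  moreover have "(\<Sum>k = - int K..int K. ?M) \<le> 3 * real K * ?M"
    using False by (simp, intro mult_right_mono) auto
  ultimately have "cmod (of_nat K * hilbert_partial x y K) \<le> real K * ?M + 3 * real K * ?M"
    by (auto intro!: norm_triangle_le)
  then have "real K * cmod (hilbert_partial x y K) \<le> real K * (4 * ?M)"
    by (simp add: norm_mult)
  then show ?thesis using False by (subst (asm) mult_le_cancel_left_pos) auto
qed

section \<open>Convergence of the symmetric partial sums\<close>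

lemma symmetric_intervals_exhaust:
  "filterlim (\<lambda>K. {- int K..int K}) (finite_subsets_at_top UNIV) sequentially"
  unfolding filterlim_finite_subsets_at_top
proof (intro allI impI, elim conjE)
  fix X :: "int set" assume X: "finite X"
  then obtain N where N: "\<And>n. n \<in> X \<Longrightarrow> \<bar>n\<bar> \<le> int N"
    by (metis finite_imageI Max_ge image_eqI nat_le_iff nat_abs_triangle_ineq order_refl int_nat_eq)
  show "\<forall>\<^sub>F K in sequentially. finite {- int K..int K} \<and> X \<subseteq> {- int K..int K} \<and> {- int K..int K} \<subseteq> UNIV"
    using eventually_ge_at_top[of N] by eventually_elim (use N in fastforce)
qed

text \<open>
  The form of the full operator, to which the partial forms converge.
\<close>
definition hilbert_form :: "(int \<Rightarrow> complex) \<Rightarrow> (int \<Rightarrow> complex) \<Rightarrow> complex"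
  where "hilbert_form x y = (\<Sum>\<^sub>\<infinity>n. hilbert x n * cnj (y n))"

lemma hilbert_form_has_sum:
  assumes "ell2 x" "ell2 y"
  shows "((\<lambda>n. hilbert x n * cnj (y n)) has_sum hilbert_form x y) UNIV"
  unfolding hilbert_form_def
  by (intro has_sum_infsum ell2_mult_summable hilbert_bounded) (use assms in auto)

lemma hilbert_form_bound:
  assumes x: "ell2 x" and y: "ell2 y"
  shows "cmod (hilbert_form x y) \<le> sqrt (energy x * energy y)"
  using ell2_mult_infsum_le[OF hilbert_bounded(1)[OF x], of "\<lambda>n. cnj (y n)"] y
  by (simp add: hilbert_form_def hilbert_isometry[OF x])

lemma hilbert_form_add_right:
  assumes "ell2 x" "ell2 y" "ell2 z"
  shows "hilbert_form x (\<lambda>n. y n + z n) = hilbert_form x y + hilbert_form x z"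
proof -
  have "((\<lambda>n. hilbert x n * cnj (y n) + hilbert x n * cnj (z n)) has_sum
      hilbert_form x y + hilbert_form x z) UNIV"
    by (intro has_sum_add hilbert_form_has_sum assms)
  then show ?thesis by (auto simp: hilbert_form_def distrib_left intro!: infsumI)
qed

lemma hilbert_partial_finite_support:
  assumes x: "ell2 x" and F: "finite F" and u: "\<And>n. n \<notin> F \<Longrightarrow> u n = 0"
  shows "hilbert_partial x u \<longlonglongrightarrow> hilbert_form x u"
proof -
  have "(\<lambda>K. \<Sum>k = - int K..int K. hilbert_kernel k * x (n - k)) \<longlonglongrightarrow> hilbert x n" for n
  proof -
    have "((\<lambda>j. hilbert_kernel (n - j) * x j) has_sum hilbert x n) UNIV"
      unfolding hilbert_def by (rule has_sum_infsum[OF hilbert_summable[OF x]])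
    then have "((\<lambda>k. hilbert_kernel (n - (n - k)) * x (n - k)) has_sum hilbert x n) UNIV"
      by (subst has_sum_reindex_bij_betw[OF bij_int_diff(1)])
    then have "(sum (\<lambda>k. hilbert_kernel k * x (n - k)) \<longlongrightarrow> hilbert x n) (finite_subsets_at_top UNIV)"
      by (simp add: has_sum_def)
    then show ?thesis by (rule filterlim_compose[OF _ symmetric_intervals_exhaust])
  qed
  then have "(\<lambda>K. \<Sum>n\<in>F. (\<Sum>k = - int K..int K. hilbert_kernel k * x (n - k)) * cnj (u n))
      \<longlonglongrightarrow> (\<Sum>n\<in>F. hilbert x n * cnj (u n))"
    by (intro tendsto_intros)
  also have "(\<Sum>n\<in>F. hilbert x n * cnj (u n)) = hilbert_form x u"
    unfolding hilbert_form_def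
    by (rule infsumI[symmetric], rule has_sum_finite_neutralI[OF F]) (use u in auto)
  also have "(\<lambda>K. \<Sum>n\<in>F. (\<Sum>k = - int K..int K. hilbert_kernel k * x (n - k)) * cnj (u n)) = hilbert_partial x u"
  proof
    fix K
    have corr: "correlation x u k = (\<Sum>n\<in>F. x (n - k) * cnj (u n))" for k
      unfolding correlation_def
      by (rule infsumI, rule has_sum_finite_neutralI[OF F]) (use u in auto)
    show "(\<Sum>n\<in>F. (\<Sum>k = - int K..int K. hilbert_kernel k * x (n - k)) * cnj (u n)) = hilbert_partial x u K"
      unfolding hilbert_partial_def corr sum_distrib_left sum_distrib_right
      by (subst sum.swap) (simp add: mult.assoc)
  qed
  finally show ?thesis .
qed

text \<open>
  Split \<open>y\<close> into a finitely supported part, for which convergence holds term by term, and a tail of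
  small energy, on which all partial forms are uniformly small.
\<close>
lemma hilbert_partial_tendsto:
  assumes x: "ell2 x" and y: "ell2 y"
  shows "hilbert_partial x y \<longlonglongrightarrow> hilbert_form x y"
proof (rule LIMSEQ_I)
  fix \<epsilon> :: real assume e: "\<epsilon> > 0"
  \<comment> \<open>The partial forms and the limit are bounded by 4 and 1 times the product of the norms, so a tail
  norm product of at most \<open>\<epsilon> / 10\<close> contributes at most half of \<open>\<epsilon>\<close>.\<close>
  define \<delta> where "\<delta> = (\<epsilon> / 10)\<^sup>2 / (1 + energy x)"
  have d: "\<delta> > 0" using e by (simp add: \<delta>_def add_pos_nonneg)
  obtain F where F: "finite F" and v: "ell2 (\<lambda>n. if n \<in> F then 0 else y n)"
    and small: "energy (\<lambda>n. if n \<in> F then 0 else y n) \<le> \<delta>"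
    using energy_tail_small[OF y d] .
  define u where "u n = (if n \<in> F then y n else 0)" for n
  define v where "v n = (if n \<in> F then 0 else y n)" for n
  have u: "ell2 u" using energy_finite_support(1)[OF F, of u] by (simp add: u_def)
  have v: "ell2 v" "energy v \<le> \<delta>" using v small by (simp_all add: v_def[abs_def])
  have y_eq: "y = (\<lambda>n. u n + v n)" by (auto simp: u_def v_def)
  have "sqrt (energy x * energy v) \<le> sqrt ((\<epsilon> / 10)\<^sup>2)"
  proof (rule real_sqrt_le_mono)
    have "energy x * energy v \<le> (1 + energy x) * \<delta>"
      using v(2) d by (intro mult_mono) auto
    also have "\<dots> = (\<epsilon> / 10)\<^sup>2"
    proof -
      have "1 + energy x \<noteq> 0" using energy_nonneg[of x] by linarith
      then show ?thesis by (simp add: \<delta>_def)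
    qed
    finally show "energy x * energy v \<le> (\<epsilon> / 10)\<^sup>2" .
  qed
  then have tail: "sqrt (energy x * energy v) \<le> \<epsilon> / 10" using e by simp
  have "hilbert_partial x u \<longlonglongrightarrow> hilbert_form x u"
    by (rule hilbert_partial_finite_support[OF x F]) (simp add: u_def)
  then obtain K0 where K0: "\<And>K. K \<ge> K0 \<Longrightarrow> cmod (hilbert_partial x u K - hilbert_form x u) < \<epsilon> / 2"
    using e LIMSEQ_D[of "hilbert_partial x u" "hilbert_form x u" "\<epsilon> / 2"] by auto
  show "\<exists>K0. \<forall>K\<ge>K0. cmod (hilbert_partial x y K - hilbert_form x y) < \<epsilon>"
  proof (intro exI allI impI)
    fix K assume K: "K \<ge> K0"
    have "hilbert_partial x y K = hilbert_partial x u K + hilbert_partial x v K"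
      unfolding y_eq hilbert_partial_def
      by (simp add: correlation_add_right[OF x u v(1)] distrib_left sum.distrib)
    moreover have "hilbert_form x y = hilbert_form x u + hilbert_form x v"
      unfolding y_eq by (rule hilbert_form_add_right[OF x u v(1)])
    ultimately have eq: "hilbert_partial x y K - hilbert_form x y
      = (hilbert_partial x u K - hilbert_form x u) + (hilbert_partial x v K - hilbert_form x v)"
      by simp
    have "cmod (hilbert_partial x v K - hilbert_form x v) \<le> \<epsilon> / 2"
      using norm_triangle_ineq4[of "hilbert_partial x v K" "hilbert_form x v"]
        hilbert_partial_bound[OF x v(1), of K] hilbert_form_bound[OF x v(1)] tail by linarith
    then show "cmod (hilbert_partial x y K - hilbert_form x y) < \<epsilon>"
      unfolding eq using K0[OF K] norm_triangle_ineq by (smt (verit) field_sum_of_halves)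
  qed
qed

text \<open>
  The kernel is Hermitian, so every symmetric partial form is real on the diagonal.
\<close>
lemma hilbert_form_real:
  assumes x: "ell2 x"
  shows "hilbert_form x x \<in> \<real>"
proof -
  have "cnj (hilbert_partial x x K) = hilbert_partial x x K" for K
  proof -
    have "cnj (hilbert_partial x x K) = (\<Sum>k = - int K..int K. hilbert_kernel (- k) * correlation x x (- k))"
      by (simp add: hilbert_partial_def cnj_hilbert_kernel correlation_uminus[OF x])
    also have "\<dots> = hilbert_partial x x K"
      unfolding hilbert_partial_def
      by (rule sum.reindex_bij_witness[of _ uminus uminus]) auto
    finally show ?thesis .
  qed
  then have "hilbert_partial x x K \<in> \<real>" for K by (simp add: Reals_cnj_iff)
  then show ?thesis
    by (intro Lim_in_closed_set[OF closed_complex_Reals _ _ hilbert_partial_tendsto[OF x x]]) auto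
qed

section \<open>The window and its autocorrelation\<close>

text \<open>
  Convolution with the Fourier coefficients of \<open>A = (3 + q) / 2\<close>, for the square wave \<open>q\<close>.
\<close>
definition mixed :: "(int \<Rightarrow> complex) \<Rightarrow> int \<Rightarrow> complex"
  where "mixed x n = (3 * x n + hilbert x n) / 2"

lemma mixed_energy:
  assumes x: "ell2 x"
  shows "ell2 (mixed x)" "energy (mixed x) = 5 / 2 * energy x + 3 / 2 * Re (hilbert_form x x)"
proof -
  have eq: "(cmod (mixed x n))\<^sup>2 = 9 / 4 * (cmod (x n))\<^sup>2 + 1 / 4 * (cmod (hilbert x n))\<^sup>2
      + 3 / 2 * Re (hilbert x n * cnj (x n))" for n
    unfolding mixed_def by (simp add: norm_divide cmod_power2 power_divide) (simp add: power2_eq_square field_simps)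
  have "((\<lambda>n. (cmod (mixed x n))\<^sup>2) has_sum
      9 / 4 * energy x + 1 / 4 * energy (hilbert x) + 3 / 2 * Re (hilbert_form x x)) UNIV"
    unfolding eq
    by (intro has_sum_add has_sum_cmult_right has_sum_Re ell2_has_sum hilbert_bounded hilbert_form_has_sum x)
  from ell2I[OF this] show "ell2 (mixed x)" "energy (mixed x) = 5 / 2 * energy x + 3 / 2 * Re (hilbert_form x x)"
    by (auto simp: hilbert_isometry[OF x])
qed

text \<open>
  The bounds \<open>1\<close> and \<open>4\<close> are the extreme values of \<open>|A|\<^sup>2 = (5 + 3 q) / 2\<close>.
\<close>
lemma mixed_energy_bounds:
  assumes x: "ell2 x"
  shows "energy x \<le> energy (mixed x)" "energy (mixed x) \<le> 4 * energy x"
proof -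
  have "\<bar>Re (hilbert_form x x)\<bar> \<le> energy x"
    using abs_Re_le_cmod[of "hilbert_form x x"] hilbert_form_bound[OF x x] by simp
  then show "energy x \<le> energy (mixed x)" "energy (mixed x) \<le> 4 * energy x"
    unfolding mixed_energy(2)[OF x] by linarith+
qed

text \<open>
  The Fourier coefficients of \<open>|A|\<^sup>2\<close>.
\<close>
definition mixed_symbol :: "int \<Rightarrow> complex"
  where "mixed_symbol k = (if k = 0 then 5 / 2 else 3 / 2 * hilbert_kernel k)"

lemma mixed_symbol_sum:
  assumes x: "ell2 x"
  shows "(\<Sum>k = - int K..int K. mixed_symbol k * correlation x x k)
    = 5 / 2 * of_real (energy x) + 3 / 2 * hilbert_partial x x K"
proof -
  have c0: "correlation x x 0 = of_real (energy x)"
  proof -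
    have "((\<lambda>n. complex_of_real ((cmod (x n))\<^sup>2)) has_sum of_real (energy x)) UNIV"
      by (rule has_sum_of_real[OF ell2_has_sum[OF x]])
    then show ?thesis by (auto simp: correlation_def complex_norm_square intro!: infsumI simp del: of_real_power)
  qed
  have "(\<Sum>k = - int K..int K. mixed_symbol k * correlation x x k)
    = (\<Sum>k = - int K..int K. (if k = 0 then 5 / 2 * correlation x x 0 else 0)
        + 3 / 2 * (hilbert_kernel k * correlation x x k))"
    by (rule sum.cong) (auto simp: mixed_symbol_def)
  also have "\<dots> = 5 / 2 * of_real (energy x) + 3 / 2 * hilbert_partial x x K"
    by (simp add: sum.distrib c0 hilbert_partial_def sum_distrib_left)
  finally show ?thesis .
qed

text \<open>
  The Fourier series of \<open>|A|\<^sup>2\<close>, summed symmetrically, converges weakly as a series of operators.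
\<close>
lemma mixed_symbol_tendsto:
  assumes x: "ell2 x"
  shows "(\<lambda>K. \<Sum>k = - int K..int K. mixed_symbol k * correlation x x k) \<longlonglongrightarrow> of_real (energy (mixed x))"
proof -
  have "(\<lambda>K. 5 / 2 * of_real (energy x) + 3 / 2 * hilbert_partial x x K)
      \<longlonglongrightarrow> 5 / 2 * of_real (energy x) + 3 / 2 * hilbert_form x x"
    by (intro tendsto_intros hilbert_partial_tendsto x)
  also have "hilbert_form x x = of_real (Re (hilbert_form x x))"
    using hilbert_form_real[OF x] by simp
  finally show ?thesis
    unfolding mixed_symbol_sum[OF x] mixed_energy(2)[OF x] by simp
qed

lemma mixed_symbol_bound:
  assumes x: "ell2 x"
  shows "cmod (\<Sum>k = - int K..int K. mixed_symbol k * correlation x x k) \<le> 9 * energy x"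
proof -
  have "cmod (5 / 2 * of_real (energy x) + 3 / 2 * hilbert_partial x x K)
      \<le> 5 / 2 * energy x + 3 / 2 * cmod (hilbert_partial x x K)"
    by (rule order_trans[OF norm_triangle_ineq]) (simp add: norm_mult)
  also have "\<dots> \<le> 9 * energy x"
  proof -
    have "cmod (hilbert_partial x x K) \<le> 4 * energy x"
      using hilbert_partial_bound[OF x x, of K] by simp
    with energy_nonneg[of x] show ?thesis by linarith
  qed
  finally show ?thesis unfolding mixed_symbol_sum[OF x] .
qed

text \<open>
  The Fourier coefficients of \<open>A\<close>.
\<close>
definition window_coeff :: "int \<Rightarrow> complex"
  where "window_coeff n = ((if n = 0 then 3 else 0) + hilbert_kernel n) / 2"

text \<open>
  Polarization of the isometry on the sum of two unit vectors; the real part suffices because the kernel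
  is purely imaginary.
\<close>
lemma hilbert_kernel_orthogonal:
  assumes "k \<noteq> 0"
  shows "((\<lambda>n. hilbert_kernel n * cnj (hilbert_kernel (n - k))) has_sum 0) UNIV"
proof -
  let ?s = hilbert_kernel
  have "((\<lambda>n. (cmod (\<Sum>j\<in>{0, k}. ?s (n - j) * 1))\<^sup>2) has_sum (\<Sum>j\<in>{0, k}. (cmod 1)\<^sup>2)) UNIV"
    by (rule hilbert_finite_isometry) simp
  then have sum: "((\<lambda>n. (cmod (?s n + ?s (n - k)))\<^sup>2) has_sum 2) UNIV"
    using assms by simp
  have "((\<lambda>n. 1 / 2 * ((cmod (?s n + ?s (n - k)))\<^sup>2 + - ((cmod (?s n))\<^sup>2 + (cmod (?s (n - k)))\<^sup>2)))
      has_sum 1 / 2 * (2 + - (energy ?s + energy (\<lambda>n. ?s (n - k))))) UNIV"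
    by (intro has_sum_cmult_right has_sum_add has_sum_uminusI sum ell2_has_sum ell2_hilbert_kernel ell2_shift)
  then have "((\<lambda>n. complex_of_real (1 / 2 * ((cmod (?s n + ?s (n - k)))\<^sup>2 + - ((cmod (?s n))\<^sup>2 + (cmod (?s (n - k)))\<^sup>2))))
      has_sum of_real 0) UNIV"
    by (intro has_sum_of_real) (simp add: ell2_hilbert_kernel ell2_shift)
  moreover have "complex_of_real (1 / 2 * ((cmod (?s n + ?s (n - k)))\<^sup>2 + - ((cmod (?s n))\<^sup>2 + (cmod (?s (n - k)))\<^sup>2)))
      = ?s n * cnj (?s (n - k))" for n
  proof -
    have "Re (?s m) = 0" for m by (simp add: hilbert_kernel_def Re_divide)
    then show ?thesis
      unfolding complex_eq_iff cmod_power2 by (simp add: power2_eq_square algebra_simps)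
  qed
  ultimately show ?thesis by simp
qed

text \<open>
  On the Fourier side, the product of \<open>A\<close> with its conjugate has coefficients \<open>mixed_symbol\<close>.
\<close>
lemma window_coeff_autocorrelation:
  "((\<lambda>n. window_coeff n * cnj (window_coeff (n - k))) has_sum mixed_symbol k) UNIV"
proof -
  let ?s = hilbert_kernel
  have ss: "((\<lambda>n. ?s n * cnj (?s (n - k))) has_sum (if k = 0 then 1 else 0)) UNIV"
  proof (cases "k = 0")
    case True
    have "((\<lambda>n. complex_of_real ((cmod (?s n))\<^sup>2)) has_sum of_real (energy ?s)) UNIV"
      by (rule has_sum_of_real[OF ell2_has_sum[OF ell2_hilbert_kernel(1)]])
    then show ?thesis using True
      by (simp add: ell2_hilbert_kernel(2) complex_norm_square del: of_real_power)
  next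
    case False
    then show ?thesis using hilbert_kernel_orthogonal[OF False] by simp
  qed
  have d1: "((\<lambda>n. if n = 0 then c else 0) has_sum c) UNIV" for c :: complex
    by (rule has_sum_finite_neutralI[of "{0}"]) auto
  have d2: "((\<lambda>n. if n = k then c else 0) has_sum c) UNIV" for c :: complex
    by (rule has_sum_finite_neutralI[of "{k}"]) auto
  have "((\<lambda>n. 1 / 4 * ((if n = 0 then (if k = 0 then 9 else 0) else 0) + (if n = 0 then 3 * cnj (?s (- k)) else 0)
      + (if n = k then 3 * ?s k else 0) + ?s n * cnj (?s (n - k)))) has_sum
     1 / 4 * ((if k = 0 then 9 else 0) + 3 * cnj (?s (- k)) + 3 * ?s k + (if k = 0 then 1 else 0))) UNIV"
    by (intro has_sum_cmult_right has_sum_add d1 d2 ss)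
  also have "(\<lambda>n. 1 / 4 * ((if n = 0 then (if k = 0 then 9 else 0) else 0) + (if n = 0 then 3 * cnj (?s (- k)) else 0)
      + (if n = k then 3 * ?s k else 0) + ?s n * cnj (?s (n - k))))
      = (\<lambda>n. window_coeff n * cnj (window_coeff (n - k)))"
    by (auto simp: window_coeff_def fun_eq_iff field_simps)
  also have "1 / 4 * ((if k = 0 then 9 else 0) + 3 * cnj (?s (- k)) + 3 * ?s k + (if k = 0 then 1 else 0)) = mixed_symbol k"
    by (simp add: mixed_symbol_def cnj_hilbert_kernel)
  finally show ?thesis .
qed

lemma ell2_window_coeff: "ell2 window_coeff"
proof -
  have "ell2 (\<lambda>n. if n = 0 then 3 else 0)" by (rule energy_finite_support[of "{0}"]) auto
  then have "ell2 (\<lambda>n. 1 / 2 * ((if n = 0 then 3 else 0) + hilbert_kernel n))"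
    by (intro conjunct1[OF ell2_cmult] ell2_add ell2_hilbert_kernel)
  then show ?thesis by (simp add: window_coeff_def[abs_def])
qed

lemma mixed_eq_window_coeff:
  assumes x: "ell2 x"
  shows "((\<lambda>j. x j * cnj (window_coeff (j - n))) has_sum mixed x n) UNIV"
proof -
  have "((\<lambda>j. if j = n then 3 * x n else 0) has_sum 3 * x n) UNIV"
    by (rule has_sum_finite_neutralI[of "{n}"]) auto
  moreover have "((\<lambda>j. hilbert_kernel (n - j) * x j) has_sum hilbert x n) UNIV"
    unfolding hilbert_def by (rule has_sum_infsum[OF hilbert_summable[OF x]])
  ultimately have "((\<lambda>j. 1 / 2 * ((if j = n then 3 * x n else 0) + hilbert_kernel (n - j) * x j)) has_sum
      1 / 2 * (3 * x n + hilbert x n)) UNIV"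
    by (intro has_sum_cmult_right has_sum_add)
  also have "(\<lambda>j. 1 / 2 * ((if j = n then 3 * x n else 0) + hilbert_kernel (n - j) * x j))
      = (\<lambda>j. x j * cnj (window_coeff (j - n)))"
    by (auto simp: window_coeff_def cnj_hilbert_kernel fun_eq_iff field_simps)
  finally show ?thesis by (simp add: mixed_def)
qed

section \<open>Interchanging sums with integrals, and periodization\<close>

text \<open>
  In finite dimension, unconditional convergence is absolute: argue for each coordinate.
\<close>
lemma summable_on_imp_abs_summable_on_euclidean:
  fixes f :: "'i \<Rightarrow> 'a::euclidean_space"
  assumes "f summable_on A"
  shows "(\<lambda>i. norm (f i)) summable_on A"
proof -
  have "(\<lambda>i. \<bar>f i \<bullet> b\<bar>) summable_on A" for b
  proof -
    have "(\<lambda>i. f i \<bullet> b) summable_on A"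
      by (rule summable_on_bounded_linear[OF bounded_linear_inner_left assms])
    then show ?thesis
      using summable_on_iff_abs_summable_on_real[of "\<lambda>i. f i \<bullet> b" A] by simp
  qed
  then have "((\<lambda>i. \<Sum>b\<in>Basis. \<bar>f i \<bullet> b\<bar>) has_sum (\<Sum>b\<in>Basis. \<Sum>\<^sub>\<infinity>i\<in>A. \<bar>f i \<bullet> b\<bar>)) A"
    by (intro has_sum_sum has_sum_infsum)
  then have "(\<lambda>i. \<Sum>b\<in>Basis. \<bar>f i \<bullet> b\<bar>) summable_on A"
    by (rule has_sum_imp_summable)
  then show ?thesis
    by (rule Infinite_Sum.abs_summable_on_comparison_test') (rule norm_le_l1)
qed

lemma summable_on_int_iff:
  fixes f :: "int \<Rightarrow> 'a::euclidean_space"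
  shows "f summable_on UNIV \<longleftrightarrow> summable (\<lambda>i. norm (f (int_decode i)))"
proof -
  have "f summable_on UNIV \<longleftrightarrow> (\<lambda>j. norm (f j)) summable_on UNIV"
    using summable_on_imp_abs_summable_on_euclidean abs_summable_summable by blast
  also have "\<dots> \<longleftrightarrow> (\<lambda>i. norm (f (int_decode i))) summable_on UNIV"
    by (rule summable_on_reindex_bij_betw[OF bij_int_decode, symmetric])
  also have "\<dots> \<longleftrightarrow> summable (\<lambda>i. norm (f (int_decode i)))"
    by (rule summable_on_UNIV_nonneg_real_iff) simp
  finally show ?thesis .
qed

lemma infsum_int_eq_suminf:
  fixes f :: "int \<Rightarrow> 'a::euclidean_space"
  shows "(\<Sum>\<^sub>\<infinity>j. f j) = (if summable (\<lambda>i. norm (f (int_decode i))) then \<Sum>i. f (int_decode i) else 0)"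
proof (cases "summable (\<lambda>i. norm (f (int_decode i)))")
  case True
  have "((\<lambda>i. f (int_decode i)) has_sum (\<Sum>i. f (int_decode i))) UNIV"
    by (rule norm_summable_imp_has_sum[OF True summable_sums[OF summable_norm_cancel[OF True]]])
  then have "(f has_sum (\<Sum>i. f (int_decode i))) UNIV"
    by (subst (asm) has_sum_reindex_bij_betw[OF bij_int_decode])
  then show ?thesis using True by (simp add: infsumI)
next
  case False
  then show ?thesis by (simp add: infsum_not_exists summable_on_int_iff)
qed

text \<open>
  The set of parameters with a summable family is measurable, as the locus where a series in the extended
  nonnegative reals is finite; off this set \<open>infsum\<close> is \<open>0\<close>.
\<close>
lemma borel_measurable_infsum_int:
  fixes f :: "int \<Rightarrow> 'b \<Rightarrow> 'a::euclidean_space"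
  assumes [measurable]: "\<And>j. f j \<in> borel_measurable M"
  shows "(\<lambda>t. \<Sum>\<^sub>\<infinity>j. f j t) \<in> borel_measurable M"
proof -
  have "(\<Sum>\<^sub>\<infinity>j. f j t) = (if (\<Sum>i. ennreal (norm (f (int_decode i) t))) \<noteq> top
      then \<Sum>i. f (int_decode i) t else 0)" for t
  proof -
    have "(\<Sum>i. ennreal (norm (f (int_decode i) t))) \<noteq> top \<longleftrightarrow> summable (\<lambda>i. norm (f (int_decode i) t))"
    proof
      assume "(\<Sum>i. ennreal (norm (f (int_decode i) t))) \<noteq> top"
      then show "summable (\<lambda>i. norm (f (int_decode i) t))"
        by (intro summable_suminf_not_top) simp_all
    next
      assume "summable (\<lambda>i. norm (f (int_decode i) t))"
      then show "(\<Sum>i. ennreal (norm (f (int_decode i) t))) \<noteq> top"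
        by (rule ennreal_suminf_neq_top) simp
    qed
    then show ?thesis by (simp only: infsum_int_eq_suminf)
  qed
  then show ?thesis by simp
qed

text \<open>
  Fubini for counting measure on the integers times \<open>M\<close>.
\<close>
lemma
  fixes f :: "int \<Rightarrow> 'b \<Rightarrow> 'a::euclidean_space"
  assumes int: "\<And>j. integrable M (f j)"
    and sum: "(\<lambda>j. LINT t|M. norm (f j t)) summable_on UNIV"
  shows AE_summable_on_int: "AE t in M. (\<lambda>j. f j t) summable_on UNIV"
    and integrable_infsum_int: "integrable M (\<lambda>t. \<Sum>\<^sub>\<infinity>j. f j t)"
    and has_sum_integral_int: "((\<lambda>j. LINT t|M. f j t) has_sum (LINT t|M. (\<Sum>\<^sub>\<infinity>j. f j t))) UNIV"
proof -
  let ?g = "\<lambda>i t. f (int_decode i) t"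
  have int': "\<And>i. integrable M (?g i)" by (rule int)
  have [measurable]: "f j \<in> borel_measurable M" for j using int[of j] by auto
  have s: "summable (\<lambda>i. LINT t|M. norm (?g i t))"
    using sum by (simp add: summable_on_int_iff)
  have "(\<integral>\<^sup>+t. (\<Sum>i. ennreal (norm (?g i t))) \<partial>M) = (\<Sum>i. \<integral>\<^sup>+t. ennreal (norm (?g i t)) \<partial>M)"
    by (intro nn_integral_suminf) auto
  also have "\<dots> = (\<Sum>i. ennreal (LINT t|M. norm (?g i t)))"
    by (intro suminf_cong nn_integral_eq_integral integrable_norm int') auto
  also have "\<dots> \<noteq> \<infinity>" using s by (simp add: ennreal_suminf_neq_top)
  finally have "AE t in M. (\<Sum>i. ennreal (norm (?g i t))) \<noteq> \<infinity>"
    by (intro nn_integral_PInf_AE) auto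
  then have ae: "AE t in M. summable (\<lambda>i. norm (?g i t))"
    by eventually_elim (auto intro: summable_suminf_not_top)
  then show "AE t in M. (\<lambda>j. f j t) summable_on UNIV" by (simp add: summable_on_int_iff)
  have m: "(\<lambda>t. \<Sum>\<^sub>\<infinity>j. f j t) \<in> borel_measurable M" by (rule borel_measurable_infsum_int) simp
  have ae_eq: "AE t in M. (\<Sum>i. ?g i t) = (\<Sum>\<^sub>\<infinity>j. f j t)"
    using ae by eventually_elim (simp add: infsum_int_eq_suminf)
  show "integrable M (\<lambda>t. \<Sum>\<^sub>\<infinity>j. f j t)"
    by (rule integrable_cong_AE_imp[OF integrable_suminf[OF int' ae s] m]) (use ae_eq in \<open>auto simp: eq_commute\<close>)
  have "(\<lambda>i. LINT t|M. ?g i t) sums (LINT t|M. (\<Sum>i. ?g i t))"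
    by (rule sums_integral[OF int' ae s])
  also have "(LINT t|M. (\<Sum>i. ?g i t)) = (LINT t|M. (\<Sum>\<^sub>\<infinity>j. f j t))"
    by (rule integral_cong_AE) (use ae_eq m in auto)
  finally have "((\<lambda>i. LINT t|M. ?g i t) has_sum (LINT t|M. (\<Sum>\<^sub>\<infinity>j. f j t))) UNIV"
    by (intro norm_summable_imp_has_sum summable_comparison_test'[OF s]) auto
  then show "((\<lambda>j. LINT t|M. f j t) has_sum (LINT t|M. (\<Sum>\<^sub>\<infinity>j. f j t))) UNIV"
    by (subst (asm) has_sum_reindex_bij_betw[OF bij_int_decode, of "\<lambda>j. LINT t|M. f j t"])
qed

text \<open>
  Cut the line into the intervals \<open>[j, j + 1)\<close> and translate each of them to \<open>[0, 1)\<close>.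
\<close>
lemma
  fixes F :: "real \<Rightarrow> 'a::euclidean_space"
  assumes F: "integrable lborel F"
  shows AE_summable_translates: "AE t in unit_interval. (\<lambda>j. F (t + of_int j)) summable_on UNIV"
    and integrable_periodization: "integrable unit_interval (\<lambda>t. \<Sum>\<^sub>\<infinity>j. F (t + of_int j))"
    and integral_periodization: "(LINT t|unit_interval. (\<Sum>\<^sub>\<infinity>j. F (t + of_int j))) = (LINT t|lborel. F t)"
proof -
  have piece: "integrable unit_interval (\<lambda>t. H (t + of_int j))"
    "(LINT t|unit_interval. H (t + of_int j)) = (LINT t|lborel. indicator {of_int j..<of_int j + 1} t *\<^sub>R H t)"
    if H: "integrable lborel H" for H :: "real \<Rightarrow> 'c::euclidean_space" and j :: int
  proof -
    have shift: "indicator {of_int j..<of_int j + 1} (of_int j + 1 * t) *\<^sub>R H (of_int j + 1 * t)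
        = indicator {0..<1} t *\<^sub>R H (t + of_int j)" for t
      by (simp add: indicator_def add.commute[of t])
    have i: "integrable lborel (\<lambda>t. indicator {of_int j..<of_int j + 1} t *\<^sub>R H t)"
      using H by (intro integrable_mult_indicator) auto
    from lborel_integrable_real_affine[OF this, of 1 "of_int j"]
    show "integrable unit_interval (\<lambda>t. H (t + of_int j))"
      unfolding shift by (subst integrable_restrict_space) (auto simp: set_integrable_def)
    have "(LINT t|unit_interval. H (t + of_int j)) = (LINT t|lborel. indicator {0..<1} t *\<^sub>R H (t + of_int j))"
      by (subst integral_restrict_space) (auto simp: set_lebesgue_integral_def)
    also have "\<dots> = (LINT t|lborel. indicator {of_int j..<of_int j + 1} t *\<^sub>R H t)"
      unfolding shift[symmetric]
      using lborel_integral_real_affine[of 1 "\<lambda>t. indicator {of_int j..<of_int j + 1} t *\<^sub>R H t" "of_int j"]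
      by simp
    finally show "(LINT t|unit_interval. H (t + of_int j))
        = (LINT t|lborel. indicator {of_int j..<of_int j + 1} t *\<^sub>R H t)" .
  qed
  let ?f = "\<lambda>j::int. \<lambda>t. indicator {of_int j..<of_int j + 1} t *\<^sub>R F t"
  have int: "integrable lborel (?f j)" for j
    using F by (intro integrable_mult_indicator) auto
  have floor: "indicator {of_int j..<of_int j + 1} t = (if j = \<lfloor>t\<rfloor> then 1 else (0::real))" for j :: int and t :: real
    using floor_eq_iff[of t j] by (auto simp: indicator_def)
  have sum: "(\<lambda>j. LINT t|lborel. norm (?f j t)) summable_on UNIV"
  proof (rule nonneg_bounded_partial_sums_imp_summable_on[where C = "LINT t|lborel. norm (F t)"])
    show "\<forall>\<^sub>F E in finite_subsets_at_top UNIV. (\<Sum>j\<in>E. LINT t|lborel. norm (?f j t)) \<le> (LINT t|lborel. norm (F t))"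
    proof (rule eventually_finite_subsets_at_top_weakI)
      fix E :: "int set" assume E: "finite E"
      have "(\<Sum>j\<in>E. LINT t|lborel. norm (?f j t)) = (LINT t|lborel. (\<Sum>j\<in>E. norm (?f j t)))"
        by (rule Bochner_Integration.integral_sum[symmetric]) (intro integrable_norm int)
      also have "\<dots> \<le> (LINT t|lborel. norm (F t))"
      proof (rule integral_mono)
        show "integrable lborel (\<lambda>t. \<Sum>j\<in>E. norm (?f j t))"
          by (intro Bochner_Integration.integrable_sum integrable_norm int)
        show "(\<Sum>j\<in>E. norm (?f j t)) \<le> norm (F t)" for t
        proof -
          have "norm (?f j t) = (if j = \<lfloor>t\<rfloor> then norm (F t) else 0)" for j by (simp add: floor)
          then show ?thesis using E by simp
        qed
      qed (use F in simp)
      finally show "(\<Sum>j\<in>E. LINT t|lborel. norm (?f j t)) \<le> (LINT t|lborel. norm (F t))" .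
    qed
  qed simp
  have total: "(\<Sum>\<^sub>\<infinity>j. ?f j t) = F t" for t
    by (rule infsumI, rule has_sum_finite_neutralI[of "{\<lfloor>t\<rfloor>}"]) (auto simp: floor)
  have "((\<lambda>j. LINT t|lborel. ?f j t) has_sum (LINT t|lborel. F t)) UNIV"
    using has_sum_integral_int[OF int sum] unfolding total .
  then have hs: "((\<lambda>j. LINT t|unit_interval. F (t + of_int j)) has_sum (LINT t|lborel. F t)) UNIV"
    by (simp add: piece(2)[OF F])
  have int': "integrable unit_interval (\<lambda>t. F (t + of_int j))" for j by (rule piece(1)[OF F])
  have sum': "(\<lambda>j. LINT t|unit_interval. norm (F (t + of_int j))) summable_on UNIV"
    using sum by (simp add: piece(2)[OF integrable_norm[OF F]])
  show "AE t in unit_interval. (\<lambda>j. F (t + of_int j)) summable_on UNIV"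
    by (rule AE_summable_on_int[OF int' sum'])
  show "integrable unit_interval (\<lambda>t. \<Sum>\<^sub>\<infinity>j. F (t + of_int j))"
    by (rule integrable_infsum_int[OF int' sum'])
  show "(LINT t|unit_interval. (\<Sum>\<^sub>\<infinity>j. F (t + of_int j))) = (LINT t|lborel. F t)"
    by (rule has_sum_unique[OF has_sum_integral_int[OF int' sum'] hs])
qed

section \<open>Frame property and symmetric convergence\<close>

definition fibre :: "(real \<Rightarrow> complex) \<Rightarrow> real \<Rightarrow> int \<Rightarrow> complex"
  where "fibre f t j = f (t + of_int j)"

lemma L2_measurable: "f \<in> L2 \<Longrightarrow> f \<in> borel_measurable borel"
  by (simp add: L2_def)

lemma L2_integrable: "f \<in> L2 \<Longrightarrow> integrable lborel (\<lambda>t. (cmod (f t))\<^sup>2)"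
  by (simp add: L2_def)

lemma L2_translation:
  assumes "f \<in> L2" shows "(\<lambda>t. f (t - c)) \<in> L2"
proof -
  have [measurable]: "f \<in> borel_measurable borel" by (rule L2_measurable[OF assms])
  have "integrable lborel (\<lambda>t. (cmod (f (- c + 1 * t)))\<^sup>2)"
    by (rule lborel_integrable_real_affine[OF L2_integrable[OF assms]]) simp
  then show ?thesis by (simp add: L2_def)
qed

lemma integrable_L2_mult:
  assumes f: "f \<in> L2" and g: "g \<in> L2"
  shows "integrable lborel (\<lambda>t. cnj (f t) * g t)"
proof -
  have [measurable]: "f \<in> borel_measurable borel" "g \<in> borel_measurable borel"
    using f g by (auto intro: L2_measurable)
  have [measurable]: "(\<lambda>t. cnj (f t)) \<in> borel_measurable borel"
    by (rule measurable_compose[of f borel borel])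
       (auto intro!: borel_measurable_continuous_onI continuous_intros)
  have i: "integrable lborel (\<lambda>t. (cmod (f t))\<^sup>2 + (cmod (g t))\<^sup>2)"
    by (intro Bochner_Integration.integrable_add L2_integrable f g)
  show ?thesis
  proof (rule Bochner_Integration.integrable_bound[OF i])
    have "cmod (cnj a * b) \<le> (cmod a)\<^sup>2 + (cmod b)\<^sup>2" for a b :: complex
      using two_mult_le_squares[of "cmod a" "cmod b"] mult_nonneg_nonneg[OF norm_ge_zero[of a] norm_ge_zero[of b]]
      unfolding norm_mult complex_mod_cnj by linarith
    then show "AE t in lborel. norm (cnj (f t) * g t) \<le> norm ((cmod (f t))\<^sup>2 + (cmod (g t))\<^sup>2)"
      by (intro AE_I2) auto
  qed simp
qed

lemma fibre_ell2:
  assumes f: "f \<in> L2"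
  shows "AE t in unit_interval. ell2 (fibre f t)"
    and "integrable unit_interval (\<lambda>t. energy (fibre f t))"
    and "(LINT t|unit_interval. energy (fibre f t)) = (L2_norm f)\<^sup>2"
  using AE_summable_translates[OF L2_integrable[OF f]] integrable_periodization[OF L2_integrable[OF f]]
    integral_periodization[OF L2_integrable[OF f]]
  by (simp_all add: ell2_def energy_def fibre_def L2_norm_def)

definition gabor_window :: "real \<Rightarrow> complex"
  where "gabor_window t = window_coeff \<lfloor>t\<rfloor>"

lemma L2_step_function:
  assumes a: "ell2 a"
  shows "(\<lambda>t. a \<lfloor>t\<rfloor>) \<in> L2"
proof -
  let ?g = "\<lambda>t::real. a \<lfloor>t\<rfloor>"
  have [measurable]: "?g \<in> borel_measurable borel" by measurable
  have "(\<integral>\<^sup>+t. ennreal ((cmod (?g t))\<^sup>2) \<partial>lborel) < \<infinity>"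
  proof -
    have eq: "ennreal ((cmod (?g t))\<^sup>2)
        = (\<Sum>i. ennreal ((cmod (a (int_decode i)))\<^sup>2) * indicator {of_int (int_decode i)..<of_int (int_decode i) + 1} t)" for t
    proof -
      have "(\<lambda>i. ennreal ((cmod (a (int_decode i)))\<^sup>2) * indicator {of_int (int_decode i)..<of_int (int_decode i) + 1} t)
          sums (\<Sum>i\<in>{int_encode \<lfloor>t\<rfloor>}. ennreal ((cmod (a (int_decode i)))\<^sup>2) * indicator {of_int (int_decode i)..<of_int (int_decode i) + 1} t)"
      proof (rule sums_finite)
        fix i assume i: "i \<notin> {int_encode \<lfloor>t\<rfloor>}"
        then have "int_decode i \<noteq> \<lfloor>t\<rfloor>" by (metis int_decode_inverse singletonI)
        then show "ennreal ((cmod (a (int_decode i)))\<^sup>2) * indicator {of_int (int_decode i)..<of_int (int_decode i) + 1} t = 0"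
          using floor_unique[of "int_decode i" t] by (auto simp: indicator_def)
      qed simp
      then show ?thesis by (simp add: sums_iff indicator_def)
    qed
    have "(\<integral>\<^sup>+t. ennreal ((cmod (?g t))\<^sup>2) \<partial>lborel)
        = (\<Sum>i. \<integral>\<^sup>+t. ennreal ((cmod (a (int_decode i)))\<^sup>2) * indicator {of_int (int_decode i)..<of_int (int_decode i) + 1} (t::real) \<partial>lborel)"
      unfolding eq by (rule nn_integral_suminf) simp
    also have "\<dots> = (\<Sum>i. ennreal ((cmod (a (int_decode i)))\<^sup>2))"
      by (subst nn_integral_cmult_indicator) simp_all
    also have "\<dots> < \<infinity>"
    proof -
      have "summable (\<lambda>i. (cmod (a (int_decode i)))\<^sup>2)"
        using a by (simp add: ell2_def summable_on_int_iff)
      from ennreal_suminf_neq_top[OF this zero_le_power2] show ?thesis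
        by (simp only: less_top infinity_ennreal_def)
    qed
    finally show ?thesis .
  qed
  then have "integrable lborel (\<lambda>t. (cmod (?g t))\<^sup>2)"
    by (intro integrableI_bounded) simp_all
  then show ?thesis by (simp add: L2_def)
qed

lemma gabor_window_L2: "gabor_window \<in> L2"
  unfolding gabor_window_def[abs_def] by (rule L2_step_function[OF ell2_window_coeff])

text \<open>
  The sum over translates runs over all values of a step function, from whatever interval it starts; hence
  there is no dependence on \<open>t\<close>.
\<close>
lemma G_gabor_window: "G gabor_window k t = mixed_symbol k"
proof -
  let ?w = window_coeff
  have "((\<lambda>n. ?w (\<lfloor>t\<rfloor> - n) * cnj (?w (\<lfloor>t\<rfloor> - n - k))) has_sum mixed_symbol k) UNIV"
    using window_coeff_autocorrelation[of k]
    by (subst has_sum_reindex_bij_betw[OF bij_int_diff(1), of "\<lambda>n. ?w n * cnj (?w (n - k))"])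
  moreover have "\<lfloor>t - of_int n - of_int k\<rfloor> = \<lfloor>t\<rfloor> - n - k" for n
    by (metis floor_diff_of_int)
  ultimately show ?thesis
    unfolding G_def gabor_window_def by (simp add: infsumI)
qed

text \<open>
  As \<open>G\<^sub>k\<close> is constant, periodizing the remaining integrand gives the correlations of the fibres.
\<close>
lemma WH_term_gabor_window:
  assumes f: "f \<in> L2"
  shows "integrable unit_interval (\<lambda>t. correlation (fibre f t) (fibre f t) k)"
    and "WH_term gabor_window f k = mixed_symbol k * (LINT t|unit_interval. correlation (fibre f t) (fibre f t) k)"
proof -
  let ?F = "\<lambda>t. cnj (f t) * f (t - of_int k)"
  have F: "integrable lborel ?F" by (rule integrable_L2_mult[OF f L2_translation[OF f]])
  have eq: "(\<Sum>\<^sub>\<infinity>j. ?F (t + of_int j)) = correlation (fibre f t) (fibre f t) k" for t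
    by (simp add: correlation_def fibre_def algebra_simps)
  show "integrable unit_interval (\<lambda>t. correlation (fibre f t) (fibre f t) k)"
    using integrable_periodization[OF F] unfolding eq .
  have "(LINT t|lborel. ?F t) = (LINT t|unit_interval. correlation (fibre f t) (fibre f t) k)"
    using integral_periodization[OF F] unfolding eq by simp
  then show "WH_term gabor_window f k = mixed_symbol k * (LINT t|unit_interval. correlation (fibre f t) (fibre f t) k)"
    by (simp add: WH_term_def G_gabor_window mult.commute)
qed

text \<open>
  The function on the unit interval whose Fourier coefficients are the frame coefficients with
  translation parameter \<open>n\<close>.
\<close>
definition fibre_coeff :: "(real \<Rightarrow> complex) \<Rightarrow> int \<Rightarrow> real \<Rightarrow> complex"
  where "fibre_coeff f n t = (\<Sum>\<^sub>\<infinity>j. fibre f t j * cnj (window_coeff (j - n)))"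

lemma fibre_coeff_eq_mixed: "ell2 (fibre f t) \<Longrightarrow> fibre_coeff f n t = mixed (fibre f t) n"
  unfolding fibre_coeff_def by (rule infsumI[OF mixed_eq_window_coeff])

text \<open>
  Modulations by integers are \<open>1\<close>-periodic and pass through the periodization.
\<close>
lemma WH_coeff_eq_fourier_coeff:
  assumes f: "f \<in> L2"
  shows "L2_inner f (modulation (of_int m) (translation (of_int n) gabor_window))
    = fourier_coeff (fibre_coeff f n) m"
proof -
  let ?g = "\<lambda>t. character m t * gabor_window (t - of_int n)"
  let ?F = "\<lambda>t. cnj (?g t) * f t"
  have gL2: "?g \<in> L2"
  proof -
    note w = L2_translation[OF gabor_window_L2, of "of_int n"]
    have [measurable]: "(\<lambda>t. gabor_window (t - of_int n)) \<in> borel_measurable borel"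
      by (rule L2_measurable[OF w])
    show ?thesis using w by (simp add: L2_def norm_mult)
  qed
  have F: "integrable lborel ?F" by (rule integrable_L2_mult[OF gL2 f])
  have "L2_inner f (modulation (of_int m) (translation (of_int n) gabor_window)) = (LINT t|lborel. ?F t)"
    by (simp add: L2_inner_def modulation_def translation_def character_def cis_conv_exp mult_ac)
  also have "\<dots> = (LINT t|unit_interval. (\<Sum>\<^sub>\<infinity>j. ?F (t + of_int j)))"
    by (rule integral_periodization[OF F, symmetric])
  also have "\<dots> = fourier_coeff (fibre_coeff f n) m"
    unfolding fourier_coeff_def
  proof (rule Bochner_Integration.integral_cong[OF refl])
    fix t assume "t \<in> space unit_interval"
    then have t: "\<lfloor>t\<rfloor> = 0" by (auto simp: space_restrict_space floor_eq_iff)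
    have "?F (t + of_int j) = fibre f t j * cnj (window_coeff (j - n)) * cnj (character m t)" for j
      by (simp add: fibre_def gabor_window_def t character_add_int mult_ac)
    then show "(\<Sum>\<^sub>\<infinity>j. ?F (t + of_int j)) = fibre_coeff f n t * cnj (character m t)"
      unfolding fibre_coeff_def by (simp only:) (rule infsum_cmult_left')
  qed
  finally show ?thesis .
qed

lemma measurable_fibre_coeff:
  assumes f: "f \<in> L2"
  shows "fibre_coeff f n \<in> borel_measurable unit_interval"
proof -
  have [measurable]: "f \<in> borel_measurable borel" by (rule L2_measurable[OF f])
  have "(\<lambda>t. fibre f t j * cnj (window_coeff (j - n))) \<in> borel_measurable unit_interval" for j
    unfolding fibre_def by (rule measurable_restrict_space1) simp
  then show ?thesis unfolding fibre_coeff_def[abs_def] by (rule borel_measurable_infsum_int)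
qed

text \<open>
  On almost every fibre these functions are the entries of \<open>mixed (fibre f t)\<close>, which are dominated
  by the energy of the fibre.
\<close>
lemma fibre_coeff_energy:
  assumes f: "f \<in> L2"
  shows "AE t in unit_interval. (\<Sum>\<^sub>\<infinity>n. (cmod (fibre_coeff f n t))\<^sup>2) = energy (mixed (fibre f t))"
    and "square_integrable_unit (fibre_coeff f n)"
    and "integrable unit_interval (\<lambda>t. \<Sum>\<^sub>\<infinity>n. (cmod (fibre_coeff f n t))\<^sup>2)"
    and "((\<lambda>n. LINT t|unit_interval. (cmod (fibre_coeff f n t))\<^sup>2) has_sum
        (LINT t|unit_interval. (\<Sum>\<^sub>\<infinity>n. (cmod (fibre_coeff f n t))\<^sup>2))) UNIV"
proof -
  note [measurable] = measurable_fibre_coeff[OF f]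
  note ae = fibre_ell2(1)[OF f]
  show "AE t in unit_interval. (\<Sum>\<^sub>\<infinity>n. (cmod (fibre_coeff f n t))\<^sup>2) = energy (mixed (fibre f t))"
    using ae by eventually_elim (simp add: fibre_coeff_eq_mixed energy_def)
  have i4: "integrable unit_interval (\<lambda>t. 4 * energy (fibre f t))"
    using fibre_ell2(2)[OF f] by simp
  have partial: "AE t in unit_interval. (\<Sum>n\<in>E. (cmod (fibre_coeff f n t))\<^sup>2) \<le> 4 * energy (fibre f t)"
    if E: "finite E" for E
    using ae
  proof eventually_elim
    fix t assume t: "ell2 (fibre f t)"
    have "(\<Sum>n\<in>E. (cmod (fibre_coeff f n t))\<^sup>2) \<le> energy (mixed (fibre f t))"
      unfolding fibre_coeff_eq_mixed[OF t] by (rule ell2_sum_le_energy[OF mixed_energy(1)[OF t] E])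
    also have "\<dots> \<le> 4 * energy (fibre f t)" by (rule mixed_energy_bounds(2)[OF t])
    finally show "(\<Sum>n\<in>E. (cmod (fibre_coeff f n t))\<^sup>2) \<le> 4 * energy (fibre f t)" .
  qed
  have int: "integrable unit_interval (\<lambda>t. (cmod (fibre_coeff f n t))\<^sup>2)" for n
    by (rule Bochner_Integration.integrable_bound[OF i4]) (use partial[of "{n}"] in auto)
  then show "square_integrable_unit (fibre_coeff f n)" by (simp add: square_integrable_unit_def)
  have sum: "(\<lambda>n. LINT t|unit_interval. norm ((cmod (fibre_coeff f n t))\<^sup>2)) summable_on UNIV"
  proof (rule nonneg_bounded_partial_sums_imp_summable_on[where C = "LINT t|unit_interval. 4 * energy (fibre f t)"])
    show "\<forall>\<^sub>F E in finite_subsets_at_top UNIV. (\<Sum>n\<in>E. LINT t|unit_interval. norm ((cmod (fibre_coeff f n t))\<^sup>2))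
        \<le> (LINT t|unit_interval. 4 * energy (fibre f t))"
    proof (rule eventually_finite_subsets_at_top_weakI)
      fix E :: "int set" assume E: "finite E"
      have "(\<Sum>n\<in>E. LINT t|unit_interval. norm ((cmod (fibre_coeff f n t))\<^sup>2))
          = (LINT t|unit_interval. (\<Sum>n\<in>E. (cmod (fibre_coeff f n t))\<^sup>2))"
        by (subst Bochner_Integration.integral_sum) (simp_all add: int)
      also have "\<dots> \<le> (LINT t|unit_interval. 4 * energy (fibre f t))"
        by (rule integral_mono_AE[OF _ i4 partial[OF E]]) (simp add: int)
      finally show "(\<Sum>n\<in>E. LINT t|unit_interval. norm ((cmod (fibre_coeff f n t))\<^sup>2))
        \<le> (LINT t|unit_interval. 4 * energy (fibre f t))" .
    qed
  qed simp
  show "integrable unit_interval (\<lambda>t. \<Sum>\<^sub>\<infinity>n. (cmod (fibre_coeff f n t))\<^sup>2)"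
    by (rule integrable_infsum_int[OF int sum])
  show "((\<lambda>n. LINT t|unit_interval. (cmod (fibre_coeff f n t))\<^sup>2) has_sum
        (LINT t|unit_interval. (\<Sum>\<^sub>\<infinity>n. (cmod (fibre_coeff f n t))\<^sup>2))) UNIV"
    by (rule has_sum_integral_int[OF int sum])
qed

text \<open>
  Parseval performs the sum over the modulations, and integration commutes with the sum over the
  translations.
\<close>
lemma WH_coeff_has_sum:
  assumes f: "f \<in> L2"
  shows "(WH_coeff_sq gabor_window f has_sum
     (LINT t|unit_interval. (\<Sum>\<^sub>\<infinity>n. (cmod (fibre_coeff f n t))\<^sup>2))) UNIV"
proof -
  let ?c = "\<lambda>(n, m). (cmod (fourier_coeff (fibre_coeff f n) m))\<^sup>2"
  let ?I = "LINT t|unit_interval. (\<Sum>\<^sub>\<infinity>n. (cmod (fibre_coeff f n t))\<^sup>2)"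
  have rows: "((\<lambda>m. ?c (n, m)) has_sum (LINT t|unit_interval. (cmod (fibre_coeff f n t))\<^sup>2)) UNIV" for n
    using parseval[OF fibre_coeff_energy(2)[OF f]] by simp
  have cols: "((\<lambda>n. LINT t|unit_interval. (cmod (fibre_coeff f n t))\<^sup>2) has_sum ?I) UNIV"
    by (rule fibre_coeff_energy(4)[OF f])
  have "(?c has_sum ?I) (UNIV \<times> UNIV)"
    by (rule has_sum_SigmaI[OF rows cols], rule summable_on_SigmaI[OF rows])
       (use cols in \<open>auto dest: has_sum_imp_summable\<close>)
  then have "((\<lambda>(m, n). ?c (n, m)) has_sum ?I) (UNIV \<times> UNIV)"
    by (subst (asm) has_sum_swap)
  moreover have "(\<lambda>(m, n). ?c (n, m)) = WH_coeff_sq gabor_window f"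
    by (simp add: WH_coeff_sq_def WH_coeff_eq_fourier_coeff[OF f])
  ultimately show ?thesis by simp
qed

lemma WH_frame_gabor_window: "WH_frame gabor_window"
  unfolding WH_frame_def
proof (rule exI[of _ 1], rule exI[of _ 4], intro conjI ballI)
  fix f assume f: "f \<in> L2"
  let ?e = "\<lambda>t. \<Sum>\<^sub>\<infinity>n. (cmod (fibre_coeff f n t))\<^sup>2"
  note hs = WH_coeff_has_sum[OF f]
  note int = fibre_ell2(2)[OF f] fibre_coeff_energy(3)[OF f]
  have ae: "AE t in unit_interval. energy (fibre f t) \<le> ?e t" "AE t in unit_interval. ?e t \<le> 4 * energy (fibre f t)"
    using fibre_ell2(1)[OF f] fibre_coeff_energy(1)[OF f]
    by (eventually_elim, simp add: mixed_energy_bounds)+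
  show "WH_coeff_sq gabor_window f summable_on UNIV" by (rule has_sum_imp_summable[OF hs])
  have "(LINT t|unit_interval. energy (fibre f t)) \<le> (LINT t|unit_interval. ?e t)"
    by (rule integral_mono_AE[OF int ae(1)])
  then show "1 * (L2_norm f)\<^sup>2 \<le> (\<Sum>\<^sub>\<infinity>mn\<in>UNIV. WH_coeff_sq gabor_window f mn)"
    using infsumI[OF hs] fibre_ell2(3)[OF f] by simp
  have "(LINT t|unit_interval. ?e t) \<le> (LINT t|unit_interval. 4 * energy (fibre f t))"
    by (rule integral_mono_AE[OF int(2) _ ae(2)]) (simp add: int)
  then show "(\<Sum>\<^sub>\<infinity>mn\<in>UNIV. WH_coeff_sq gabor_window f mn) \<le> 4 * (L2_norm f)\<^sup>2"
    using infsumI[OF hs] fibre_ell2(3)[OF f] by simp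
qed auto

text \<open>
  Fibrewise convergence is dominated by a multiple of the energy of the fibre.
\<close>
lemma WH_identity_symmetric:
  assumes f: "f \<in> L2"
  shows "(\<lambda>K::nat. \<Sum>k = - int K..int K. WH_term gabor_window f k)
    \<longlonglongrightarrow> complex_of_real (\<Sum>\<^sub>\<infinity>mn\<in>UNIV. WH_coeff_sq gabor_window f mn)"
proof -
  let ?s = "\<lambda>K t. \<Sum>k = - int K..int K. mixed_symbol k * correlation (fibre f t) (fibre f t) k"
  let ?e = "\<lambda>t. \<Sum>\<^sub>\<infinity>n. (cmod (fibre_coeff f n t))\<^sup>2"
  note corr = WH_term_gabor_window(1)[OF f]
  have "(\<lambda>K. LINT t|unit_interval. ?s K t) \<longlonglongrightarrow> (LINT t|unit_interval. complex_of_real (?e t))"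
  proof (rule integral_dominated_convergence)
    show "(\<lambda>t. complex_of_real (?e t)) \<in> borel_measurable unit_interval"
      using measurable_compose[OF borel_measurable_integrable[OF fibre_coeff_energy(3)[OF f]], of complex_of_real borel]
      by simp
    show "?s K \<in> borel_measurable unit_interval" for K
      using corr by (intro borel_measurable_integrable) simp
    show "integrable unit_interval (\<lambda>t. 9 * energy (fibre f t))"
      using fibre_ell2(2)[OF f] by simp
    show "AE t in unit_interval. (\<lambda>K. ?s K t) \<longlonglongrightarrow> complex_of_real (?e t)"
      using fibre_ell2(1)[OF f] fibre_coeff_energy(1)[OF f]
      by eventually_elim (simp only: mixed_symbol_tendsto)
    show "AE t in unit_interval. norm (?s K t) \<le> 9 * energy (fibre f t)" for K
      using fibre_ell2(1)[OF f] by eventually_elim (rule mixed_symbol_bound)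
  qed
  moreover have "(LINT t|unit_interval. ?s K t) = (\<Sum>k = - int K..int K. WH_term gabor_window f k)" for K
    using corr by (simp add: WH_term_gabor_window(2)[OF f])
  ultimately show ?thesis
    by (simp add: infsumI[OF WH_coeff_has_sum[OF f]])
qed

section \<open>Divergence of the one-sided sums\<close>

text \<open>
  All fibres of a step function over \<open>[0, 1)\<close> coincide.
\<close>
lemma WH_term_step_function:
  assumes a: "ell2 a"
  shows "WH_term gabor_window (\<lambda>t. a \<lfloor>t\<rfloor>) k = mixed_symbol k * correlation a a k"
proof -
  have "(LINT t|unit_interval. correlation (fibre (\<lambda>t. a \<lfloor>t\<rfloor>) t) (fibre (\<lambda>t. a \<lfloor>t\<rfloor>) t) k)
      = (LINT t|unit_interval. correlation a a k)"
  proof (rule Bochner_Integration.integral_cong[OF refl])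
    fix t assume "t \<in> space unit_interval"
    then have "\<lfloor>t\<rfloor> = 0" by (auto simp: space_restrict_space floor_eq_iff)
    then have "fibre (\<lambda>t. a \<lfloor>t\<rfloor>) t = a" by (simp add: fibre_def fun_eq_iff)
    then show "correlation (fibre (\<lambda>t. a \<lfloor>t\<rfloor>) t) (fibre (\<lambda>t. a \<lfloor>t\<rfloor>) t) k = correlation a a k" by simp
  qed
  also have "\<dots> = correlation a a k" by (simp add: space_restrict_space)
  finally show ?thesis by (simp add: WH_term_gabor_window(2)[OF L2_step_function[OF a]])
qed

text \<open>
  Square-summable, but barely: the tail of its squares from \<open>k\<close> on is of order \<open>1 / ln k\<close>. The summand
  \<open>1\<close> next to the logarithm makes it antitone from \<open>n = 1\<close> on; its value at \<open>0\<close> is \<open>0\<close>.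
\<close>
definition slow_seq :: "nat \<Rightarrow> real"
  where "slow_seq n = 1 / (sqrt (real n) * (1 + ln (real n)))"

lemma slow_seq_sq: "(slow_seq n)\<^sup>2 = 1 / (real n * (1 + ln (real n))\<^sup>2)"
  by (simp add: slow_seq_def power_divide power_mult_distrib)

lemma slow_seq_nonneg [simp]: "0 \<le> slow_seq n"
  by (cases "n = 0") (auto simp: slow_seq_def)

lemma slow_seq_antimono:
  assumes "0 < m" "m \<le> n" shows "slow_seq n \<le> slow_seq m"
proof -
  have "sqrt (real m) * (1 + ln (real m)) \<le> sqrt (real n) * (1 + ln (real n))"
    using assms by (intro mult_mono add_mono) auto
  moreover have "0 < sqrt (real m) * (1 + ln (real m))"
    using assms by (intro mult_pos_pos add_pos_nonneg) auto
  ultimately show ?thesis unfolding slow_seq_def by (intro frac_le) auto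
qed

lemma summable_slow_seq_sq: "summable (\<lambda>n. (slow_seq n)\<^sup>2)"
proof -
  have "summable (\<lambda>n. 2 ^ n * (slow_seq (2 ^ n))\<^sup>2)"
  proof (rule summable_comparison_test')
    have "summable (\<lambda>n. 1 / (real n + 1)\<^sup>2)"
      using inverse_squares_sums by (simp add: sums_iff add.commute)
    then show "summable (\<lambda>n. 1 / (ln 2)\<^sup>2 * (1 / (real n + 1)\<^sup>2))" by (rule summable_mult)
    fix n :: nat
    have "2 ^ n * (slow_seq (2 ^ n))\<^sup>2 = 1 / (1 + real n * ln 2)\<^sup>2"
      by (simp add: slow_seq_sq ln_realpow)
    also have "\<dots> \<le> 1 / (ln 2 * (real n + 1))\<^sup>2"
    proof (intro divide_left_mono power_mono mult_pos_pos zero_less_power)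
      show "ln 2 * (real n + 1) \<le> 1 + real n * ln 2"
        using ln_2_less_1 by (simp add: algebra_simps)
    qed (auto intro!: add_pos_nonneg)
    finally show "norm (2 ^ n * (slow_seq (2 ^ n))\<^sup>2) \<le> 1 / (ln 2)\<^sup>2 * (1 / (real n + 1)\<^sup>2)"
      by (simp add: power_mult_distrib)
  qed
  then show ?thesis
    by (subst condensation_test) (auto intro!: power_mono slow_seq_antimono)
qed

lemma not_summable_reciprocal_n_ln: "\<not> summable (\<lambda>n. 1 / (real n * (1 + ln (real n))))"
proof
  assume "summable (\<lambda>n. 1 / (real n * (1 + ln (real n))))"
  then have "summable (\<lambda>n. 2 ^ n * (1 / (real (2 ^ n) * (1 + ln (real (2 ^ n))))))"
  proof (subst (asm) condensation_test)
    show "1 / (real (Suc m) * (1 + ln (real (Suc m)))) \<le> 1 / (real m * (1 + ln (real m)))" if "0 < m" for m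
      using that by (intro divide_left_mono mult_mono mult_pos_pos add_pos_nonneg) auto
    show "0 \<le> 1 / (real n * (1 + ln (real n)))" for n by (cases "n = 0") auto
  qed
  moreover have "2 ^ n * (1 / (real (2 ^ n) * (1 + ln (real (2 ^ n))))) = 1 / (1 + real n * ln 2)" for n
    by (simp add: ln_realpow)
  ultimately have s: "summable (\<lambda>n. 1 / (1 + real n * ln 2))" by simp
  have "summable (\<lambda>n. inverse (real (Suc n)))"
  proof (rule summable_comparison_test'[OF s])
    fix n :: nat
    have "1 + real n * ln 2 \<le> real (Suc n)"
      using mult_left_mono[of "ln 2" 1 "real n"] ln_2_less_1 by simp
    then show "norm (inverse (real (Suc n))) \<le> 1 / (1 + real n * ln 2)"
      unfolding inverse_eq_divide by (auto intro!: divide_left_mono mult_pos_pos add_pos_nonneg)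
  qed
  then have "summable (\<lambda>n. inverse (real n))" by (subst (asm) summable_Suc_iff)
  then show False using not_summable_harmonic[where 'a = real] by simp
qed

text \<open>
  Telescoping: by \<open>ln (1 + x) \<le> x\<close>, the logarithm of \<open>(2 i + 3) / (2 i + 1)\<close> is at most twice the
  summand.
\<close>
lemma odd_reciprocal_sum_ge_ln: "ln (2 * real i + 1) / 2 \<le> (\<Sum>l<i. 1 / (2 * real l + 1))"
proof (induction i)
  case 0
  then show ?case by simp
next
  case (Suc i)
  have "x * (1 + 2 / x) = x + 2" if "x \<noteq> 0" for x :: real
    using that by (simp add: distrib_left)
  from this[of "2 * real i + 1"]
  have "ln (2 * real (Suc i) + 1) = ln ((2 * real i + 1) * (1 + 2 / (2 * real i + 1)))"
    by simp
  also have "\<dots> = ln (2 * real i + 1) + ln (1 + 2 / (2 * real i + 1))"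
    by (rule ln_mult_pos) (auto intro!: add_pos_nonneg)
  also have "ln (1 + 2 / (2 * real i + 1)) \<le> 2 / (2 * real i + 1)"
    by (rule ln_add_one_self_le_self) simp
  finally show ?case using Suc.IH by simp
qed

definition slow_coeff :: "int \<Rightarrow> complex"
  where "slow_coeff n = (if 0 < n then of_real (slow_seq (nat n)) else 0)"

lemma ell2_slow_coeff: "ell2 slow_coeff"
proof (rule ell2_boundedI(1))
  fix F :: "int set" assume F: "finite F"
  have "(\<Sum>n\<in>F. (cmod (slow_coeff n))\<^sup>2) = (\<Sum>n\<in>{n\<in>F. 0 < n}. (slow_seq (nat n))\<^sup>2)"
    using F by (intro sum.mono_neutral_cong_right) (auto simp: slow_coeff_def)
  also have "\<dots> = (\<Sum>n\<in>nat ` {n\<in>F. 0 < n}. (slow_seq n)\<^sup>2)"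
    by (subst sum.reindex) (auto simp: inj_on_def)
  also have "\<dots> \<le> (\<Sum>n. (slow_seq n)\<^sup>2)"
    by (rule sum_le_suminf[OF summable_slow_seq_sq]) (use F in auto)
  finally show "(\<Sum>n\<in>F. (cmod (slow_coeff n))\<^sup>2) \<le> (\<Sum>n. (slow_seq n)\<^sup>2)" .
qed

text \<open>
  The entries are nonnegative and decreasing, so the product of entries at distance \<open>k\<close> is at least the
  square of the smaller one.
\<close>
lemma slow_coeff_correlation:
  shows "Im (correlation slow_coeff slow_coeff k) = 0"
    and "0 \<le> Re (correlation slow_coeff slow_coeff k)"
    and "k > 0 \<Longrightarrow> (\<Sum>n\<in>{nat k<..N}. (slow_seq n)\<^sup>2) \<le> Re (correlation slow_coeff slow_coeff k)"
proof -
  let ?b = slow_coeff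
  have hs: "((\<lambda>n. ?b (n - k) * cnj (?b n)) has_sum correlation ?b ?b k) UNIV"
    by (rule correlation_has_sum[OF ell2_slow_coeff ell2_slow_coeff])
  have im: "Im (?b (n - k) * cnj (?b n)) = 0" and re: "0 \<le> Re (?b (n - k) * cnj (?b n))" for n
    by (simp_all add: slow_coeff_def)
  show "Im (correlation ?b ?b k) = 0"
    using has_sum_unique[OF has_sum_Im[OF hs], of 0] by (simp only: im has_sum_0_simp)
  show "0 \<le> Re (correlation ?b ?b k)"
    by (rule has_sum_nonneg[OF has_sum_Re[OF hs]]) (rule re)
  assume k: "k > 0"
  have "(\<Sum>n\<in>{nat k<..N}. (slow_seq n)\<^sup>2) \<le> (\<Sum>n\<in>{nat k<..N}. Re (?b (int n - k) * cnj (?b (int n))))"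
  proof (rule sum_mono)
    fix n assume n: "n \<in> {nat k<..N}"
    then have "slow_seq n \<le> slow_seq (nat (int n - k))"
      using k by (intro slow_seq_antimono) auto
    then have le: "(slow_seq n)\<^sup>2 \<le> slow_seq (nat (int n - k)) * slow_seq n"
      unfolding power2_eq_square by (rule mult_right_mono) simp
    show "(slow_seq n)\<^sup>2 \<le> Re (?b (int n - k) * cnj (?b (int n)))"
    proof -
      have "k < int n" "0 < n" using n k by auto
      with le show ?thesis by (simp add: slow_coeff_def)
    qed
  qed
  also have "\<dots> = (\<Sum>n\<in>int ` {nat k<..N}. Re (?b (n - k) * cnj (?b n)))"
    by (simp add: sum.reindex)
  also have "\<dots> \<le> Re (correlation ?b ?b k)"
    by (rule finite_sum_le_has_sum[OF has_sum_Re[OF hs]]) (use re in auto)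
  finally show "(\<Sum>n\<in>{nat k<..N}. (slow_seq n)\<^sup>2) \<le> Re (correlation ?b ?b k)" .
qed

text \<open>
  Exchange the order of summation: \<open>(slow_seq n)\<^sup>2\<close> is multiplied by the reciprocals of all odd numbers
  below \<open>n\<close>, whose sum is at least \<open>ln n / 2\<close>. As \<open>ln n \<ge> 2/3\<close> from \<open>n = 2\<close> on, \<open>ln n / 2\<close> is at
  least \<open>(1 + ln n) / 6\<close>, which cancels one of the two logarithmic factors.
\<close>
lemma slow_double_sum:
  "1 / 6 * (\<Sum>n\<in>{1<..2 * L}. 1 / (real n * (1 + ln (real n))))
     \<le> (\<Sum>l<L. 1 / (2 * real l + 1) * (\<Sum>n\<in>{2 * l + 1<..2 * L}. (slow_seq n)\<^sup>2))"
proof -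
  have inner: "1 / 6 * (1 / (real n * (1 + ln (real n))))
      \<le> (slow_seq n)\<^sup>2 * (\<Sum>l<n div 2. 1 / (2 * real l + 1))" if n: "1 < n" for n
  proof -
    have "2 / 3 \<le> ln (2::real)" by (rule ln2_ge_two_thirds)
    also have "\<dots> \<le> ln (real n)" using n by simp
    finally have ln: "2 / 3 \<le> ln (real n)" .
    have "real n \<le> 2 * real (n div 2) + 1" by linarith
    then have "ln (real n) / 2 \<le> ln (2 * real (n div 2) + 1) / 2" using n by simp
    also have "\<dots> \<le> (\<Sum>l<n div 2. 1 / (2 * real l + 1))" by (rule odd_reciprocal_sum_ge_ln)
    finally have S: "ln (real n) / 2 \<le> (\<Sum>l<n div 2. 1 / (2 * real l + 1))" .
    have "1 / 6 * (1 / (real n * (1 + ln (real n)))) = (slow_seq n)\<^sup>2 * ((1 + ln (real n)) / 6)"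
    proof -
      have "1 + ln (real n) \<noteq> 0" using ln by linarith
      then show ?thesis unfolding slow_seq_sq by (simp add: power2_eq_square)
    qed
    also have "\<dots> \<le> (slow_seq n)\<^sup>2 * (ln (real n) / 2)"
      using ln by (intro mult_left_mono) (simp_all add: field_simps)
    also have "\<dots> \<le> (slow_seq n)\<^sup>2 * (\<Sum>l<n div 2. 1 / (2 * real l + 1))"
      by (rule mult_left_mono[OF S]) simp
    finally show ?thesis .
  qed
  have "1 / 6 * (\<Sum>n\<in>{1<..2 * L}. 1 / (real n * (1 + ln (real n))))
      \<le> (\<Sum>n\<in>{1<..2 * L}. (slow_seq n)\<^sup>2 * (\<Sum>l<n div 2. 1 / (2 * real l + 1)))"
    unfolding sum_distrib_left by (rule sum_mono) (use inner in \<open>simp add: sum_distrib_left\<close>)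
  also have "\<dots> = (\<Sum>n\<in>{1<..2 * L}. \<Sum>l\<in>{..<n div 2}. 1 / (2 * real l + 1) * (slow_seq n)\<^sup>2)"
    by (simp add: sum_distrib_left mult.commute)
  also have "\<dots> = (\<Sum>l<L. \<Sum>n\<in>{2 * l + 1<..2 * L}. 1 / (2 * real l + 1) * (slow_seq n)\<^sup>2)"
    unfolding sum.Sigma[OF finite_greaterThanAtMost ballI[OF finite_lessThan]]
      sum.Sigma[OF finite_lessThan ballI[OF finite_greaterThanAtMost]]
    by (rule sum.reindex_bij_witness[of _ prod.swap prod.swap]) auto
  finally show ?thesis by (simp add: sum_distrib_left)
qed

text \<open>
  For \<open>k > 0\<close> the terms lie on the negative imaginary axis, so nothing cancels, and those with odd \<open>k\<close> have
  modulus \<open>3 / (\<pi> k)\<close> times the correlation.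
\<close>
lemma one_sided_sum_lower_bound:
  "1 / (2 * pi) * (\<Sum>n\<in>{1<..2 * L}. 1 / (real n * (1 + ln (real n))))
     \<le> - Im (\<Sum>k = 1..int (2 * L). WH_term gabor_window (\<lambda>t. slow_coeff \<lfloor>t\<rfloor>) k)"
proof -
  let ?r = "\<lambda>k. Re (correlation slow_coeff slow_coeff k)"
  define c where "c k = (if odd k then 3 / (pi * of_int k) * ?r k else 0)" for k :: int
  have term_eq: "- Im (WH_term gabor_window (\<lambda>t. slow_coeff \<lfloor>t\<rfloor>) k) = c k" if "k > 0" for k
  proof -
    have "correlation slow_coeff slow_coeff k = of_real (?r k)"
      by (simp add: complex_eq_iff slow_coeff_correlation)
    moreover have "mixed_symbol k = (if odd k then - (\<i> * of_real (3 / (pi * of_int k))) else 0)"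
      using that by (simp add: mixed_symbol_def hilbert_kernel_def divide_simps)
    ultimately show ?thesis
      unfolding WH_term_step_function[OF ell2_slow_coeff] c_def by auto
  qed
  have c_nonneg: "0 \<le> c k" if "k > 0" for k
    using that slow_coeff_correlation(2)[of k] by (simp add: c_def)
  have "1 / (2 * pi) * (\<Sum>n\<in>{1<..2 * L}. 1 / (real n * (1 + ln (real n))))
      = 3 / pi * (1 / 6 * (\<Sum>n\<in>{1<..2 * L}. 1 / (real n * (1 + ln (real n)))))" by simp
  also have "\<dots> \<le> 3 / pi * (\<Sum>l<L. 1 / (2 * real l + 1) * (\<Sum>n\<in>{2 * l + 1<..2 * L}. (slow_seq n)\<^sup>2))"
    by (intro mult_left_mono slow_double_sum) simp
  also have "\<dots> = (\<Sum>l<L. 3 / (pi * (2 * real l + 1)) * (\<Sum>n\<in>{2 * l + 1<..2 * L}. (slow_seq n)\<^sup>2))"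
    by (simp add: sum_distrib_left)
  also have "\<dots> \<le> (\<Sum>l<L. c (2 * int l + 1))"
  proof (rule sum_mono)
    fix l
    have "(\<Sum>n\<in>{2 * l + 1<..2 * L}. (slow_seq n)\<^sup>2) \<le> ?r (2 * int l + 1)"
      using slow_coeff_correlation(3)[of "2 * int l + 1" "2 * L"] by (simp add: nat_add_distrib nat_mult_distrib)
    then have "3 / (pi * (2 * real l + 1)) * (\<Sum>n\<in>{2 * l + 1<..2 * L}. (slow_seq n)\<^sup>2)
        \<le> 3 / (pi * (2 * real l + 1)) * ?r (2 * int l + 1)"
      by (rule mult_left_mono) simp
    then show "3 / (pi * (2 * real l + 1)) * (\<Sum>n\<in>{2 * l + 1<..2 * L}. (slow_seq n)\<^sup>2) \<le> c (2 * int l + 1)"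
      by (simp add: c_def)
  qed
  also have "\<dots> = (\<Sum>k\<in>(\<lambda>l. 2 * int l + 1) ` {..<L}. c k)"
    by (subst sum.reindex) (auto simp: inj_on_def)
  also have "\<dots> \<le> (\<Sum>k = 1..int (2 * L). c k)"
    by (rule sum_mono2) (auto intro: c_nonneg)
  also have "\<dots> = - Im (\<Sum>k = 1..int (2 * L). WH_term gabor_window (\<lambda>t. slow_coeff \<lfloor>t\<rfloor>) k)"
    unfolding Im_sum sum_negf[symmetric] by (rule sum.cong) (use term_eq in auto)
  finally show ?thesis .
qed

text \<open>
  If the double limit existed, fixing a large lower end would bound the sums over \<open>{1..K}\<close>, and thus the
  partial sums of \<open>\<Sum> 1 / (n * (1 + ln n))\<close>.
\<close>
lemma WH_series_diverges:
  "\<not> (\<exists>l::complex. ((\<lambda>(K::nat, L::nat). \<Sum>k = - int L..int K. WH_term gabor_window (\<lambda>t. slow_coeff \<lfloor>t\<rfloor>) k) \<longlongrightarrow> l)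
      (sequentially \<times>\<^sub>F sequentially))"
proof
  let ?w = "WH_term gabor_window (\<lambda>t. slow_coeff \<lfloor>t\<rfloor>)"
  let ?a = "\<lambda>n. 1 / (real n * (1 + ln (real n)))"
  assume "\<exists>l::complex. ((\<lambda>(K::nat, L::nat). \<Sum>k = - int L..int K. ?w k) \<longlongrightarrow> l) (sequentially \<times>\<^sub>F sequentially)"
  then obtain l where "((\<lambda>(K::nat, L::nat). \<Sum>k = - int L..int K. ?w k) \<longlongrightarrow> l) (sequentially \<times>\<^sub>F sequentially)" ..
  then have "\<forall>\<^sub>F p in sequentially \<times>\<^sub>F sequentially. dist ((\<lambda>(K, L). \<Sum>k = - int L..int K. ?w k) p) l < 1"
    by (rule tendstoD) simp
  then obtain N where N: "\<And>K L. K \<ge> N \<Longrightarrow> L \<ge> N \<Longrightarrow> dist (\<Sum>k = - int L..int K. ?w k) l < 1"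
    unfolding eventually_prod_sequentially by auto
  define A where "A = (\<Sum>k = - int N..0. ?w k)"
  have nonneg: "0 \<le> ?a n" for n by (cases "n = 0") auto
  have bound: "(\<Sum>n\<in>{1<..2 * K}. ?a n) \<le> 2 * pi * (1 + cmod l + cmod A)" if K: "K \<ge> N" for K
  proof -
    have "{- int N..int (2 * K)} = {- int N..0} \<union> {1..int (2 * K)}" by auto
    then have "(\<Sum>k = - int N..int (2 * K). ?w k) = A + (\<Sum>k = 1..int (2 * K). ?w k)"
      unfolding A_def by (simp add: sum.union_disjoint disjoint_iff)
    then have eq: "(\<Sum>k = 1..int (2 * K). ?w k) = ((\<Sum>k = - int N..int (2 * K). ?w k) - l) + (l - A)" by simp
    have "cmod (\<Sum>k = 1..int (2 * K). ?w k) \<le> 1 + cmod l + cmod A"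
    proof -
      have "cmod ((\<Sum>k = - int N..int (2 * K). ?w k) - l) < 1"
        using N[of "2 * K" N] K by (simp add: dist_norm)
      then show ?thesis unfolding eq
        using norm_triangle_ineq[of "(\<Sum>k = - int N..int (2 * K). ?w k) - l" "l - A"] norm_triangle_ineq4[of l A]
        by linarith
    qed
    then have "1 / (2 * pi) * (\<Sum>n\<in>{1<..2 * K}. ?a n) \<le> 1 + cmod l + cmod A"
      using one_sided_sum_lower_bound[of K] abs_Im_le_cmod[of "\<Sum>k = 1..int (2 * K). ?w k"] by linarith
    then show ?thesis by (simp add: field_simps)
  qed
  have "summable ?a"
  proof (rule summableI_nonneg_bounded[OF nonneg])
    fix M :: nat
    have "(\<Sum>n<M. ?a n) \<le> (\<Sum>n\<in>{..2 * max M N}. ?a n)"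
      by (rule sum_mono2) (use nonneg in auto)
    also have "{..2 * max M N} \<subseteq> {0, 1} \<union> {1<..2 * max M N}" by auto
    then have "(\<Sum>n\<in>{..2 * max M N}. ?a n) \<le> (\<Sum>n\<in>{0, 1} \<union> {1<..2 * max M N}. ?a n)"
      by (intro sum_mono2) (use nonneg in auto)
    also have "\<dots> = 1 + (\<Sum>n\<in>{1<..2 * max M N}. ?a n)"
      by (subst sum.union_disjoint) auto
    also have "\<dots> \<le> 1 + 2 * pi * (1 + cmod l + cmod A)"
      by (intro add_left_mono bound) simp
    finally show "(\<Sum>n<M. ?a n) \<le> 1 + 2 * pi * (1 + cmod l + cmod A)" .
  qed
  then show False using not_summable_reciprocal_n_ln by simp
qed

theorem corollary5p8:
  "\<exists>g\<in>L2. WH_frame g \<and>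
     (\<forall>f\<in>L2. (\<lambda>K::nat. \<Sum>k = - int K..int K. WH_term g f k)
        \<longlonglongrightarrow> complex_of_real (\<Sum>\<^sub>\<infinity>mn\<in>UNIV. WH_coeff_sq g f mn)) \<and>
     (\<exists>h\<in>L2. \<not> (\<exists>l::complex.
        ((\<lambda>(K::nat, L::nat). \<Sum>k = - int L..int K. WH_term g h k) \<longlongrightarrow> l)
          (sequentially \<times>\<^sub>F sequentially)))"
  by (intro bexI[of _ gabor_window] conjI ballI bexI[of _ "\<lambda>t. slow_coeff \<lfloor>t\<rfloor>"]
      WH_frame_gabor_window WH_identity_symmetric WH_series_diverges gabor_window_L2
      L2_step_function ell2_slow_coeff)

end
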